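(* Let $p$ be a prime, $G$ a finite $p$-group, and $N$ a normal subgroup of $G$. Assume that one of the following holds: (a) $p=2$ and $N$ is abelian with no subgroup isomorphic to $C_{2^k}\times C_{2^k}$, where $2^k=\exp G$; (b) $p>2$ and $N$ is a powerful $p$-group. Assume moreover that one of the following holds: (c) $\mathrm{M}(G/N)=1$; (d) $G=N\rtimes H$ for a subgroup $H$ of $G$ such that $\exp \mathrm{M}(H)$ divides $\exp H$. Then $\exp \mathrm{M}(G)$ divides $\exp G$.
   Context: $\mathrm{M}(G)=H^2(G,\mathbb{C}^\times)$ (trivial action) is the Schur multiplier of the finite group $G$; $\exp$ is the exponent; $C_n$ is the cyclic group of order $n$. For $p>2$, a finite $p$-group $P$ is powerful if its derived subgroup satisfies $P'\le\mho(P)$, where $\mho(P)=\langle g^p\mid g\in P\rangle$. *)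

theory Defs
  imports Complex_Main "HOL-Computational_Algebra.Primes"
    "HOL-Algebra.Elementary_Groups" "HOL-Algebra.Product_Groups"
begin

definition finite_p_group :: "nat \<Rightarrow> ('a, 'b) monoid_scheme \<Rightarrow> bool" where
  "finite_p_group p G \<longleftrightarrow> group G \<and> finite (carrier G) \<and> (\<exists>n. order G = p ^ n)"

text \<open>The value 0 stands for an infinite exponent.\<close>

definition group_exponent :: "('a, 'b) monoid_scheme \<Rightarrow> nat" where
  "group_exponent G =
     (if \<exists>n>0. \<forall>g \<in> carrier G. g [^]\<^bsub>G\<^esub> (n::nat) = \<one>\<^bsub>G\<^esub>
      then LEAST n. n > 0 \<and> (\<forall>g \<in> carrier G. g [^]\<^bsub>G\<^esub> n = \<one>\<^bsub>G\<^esub>)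
      else 0)"

definition agemo :: "nat \<Rightarrow> ('a, 'b) monoid_scheme \<Rightarrow> 'a set" where
  "agemo p P = generate P {g [^]\<^bsub>P\<^esub> p | g. g \<in> carrier P}"

text \<open>This is the usual notion for odd primes only; for \<open>p = 2\<close> one asks
  for the fourth powers instead of the squares.\<close>

definition powerful_p_group :: "nat \<Rightarrow> ('a, 'b) monoid_scheme \<Rightarrow> bool" where
  "powerful_p_group p P \<longleftrightarrow> finite_p_group p P \<and> derived P (carrier P) \<subseteq> agemo p P"

definition complex_units :: "complex monoid" where
  "complex_units = \<lparr>carrier = - {0}, monoid.mult = (*), one = 1\<rparr>"

text \<open>Second cohomology of \<open>G\<close> with coefficients in an abelian group \<open>A\<close>, written
  multiplicatively, on which \<open>G\<close> acts trivially: inhomogeneous 2-cocycles modulo coboundaries.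
  Cochains are extensional functions, so that the pointwise product makes them a group.\<close>

definition cochains2 ::
    "('a, 'b) monoid_scheme \<Rightarrow> ('c, 'd) monoid_scheme \<Rightarrow> ('a \<times> 'a \<Rightarrow> 'c) monoid" where
  "cochains2 G A = product_group (carrier G \<times> carrier G) (\<lambda>_. A)"

definition cocycles2 ::
    "('a, 'b) monoid_scheme \<Rightarrow> ('c, 'd) monoid_scheme \<Rightarrow> ('a \<times> 'a \<Rightarrow> 'c) set" where
  "cocycles2 G A = {f \<in> carrier (cochains2 G A).
     \<forall>g \<in> carrier G. \<forall>h \<in> carrier G. \<forall>k \<in> carrier G.
       f (g, h) \<otimes>\<^bsub>A\<^esub> f (g \<otimes>\<^bsub>G\<^esub> h, k) = f (h, k) \<otimes>\<^bsub>A\<^esub> f (g, h \<otimes>\<^bsub>G\<^esub> k)}"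

definition coboundary2 ::
    "('a, 'b) monoid_scheme \<Rightarrow> ('c, 'd) monoid_scheme \<Rightarrow> ('a \<Rightarrow> 'c) \<Rightarrow> 'a \<times> 'a \<Rightarrow> 'c" where
  "coboundary2 G A u = (\<lambda>(g, h) \<in> carrier G \<times> carrier G.
     u g \<otimes>\<^bsub>A\<^esub> u h \<otimes>\<^bsub>A\<^esub> inv\<^bsub>A\<^esub> u (g \<otimes>\<^bsub>G\<^esub> h))"

definition coboundaries2 ::
    "('a, 'b) monoid_scheme \<Rightarrow> ('c, 'd) monoid_scheme \<Rightarrow> ('a \<times> 'a \<Rightarrow> 'c) set" where
  "coboundaries2 G A = coboundary2 G A ` (carrier G \<rightarrow> carrier A)"

definition cohomology2 ::
    "('a, 'b) monoid_scheme \<Rightarrow> ('c, 'd) monoid_scheme \<Rightarrow> ('a \<times> 'a \<Rightarrow> 'c) set monoid" where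
  "cohomology2 G A = (cochains2 G A)\<lparr>carrier := cocycles2 G A\<rparr> Mod coboundaries2 G A"

definition schur_multiplier ::
    "('a, 'b) monoid_scheme \<Rightarrow> ('a \<times> 'a \<Rightarrow> complex) set monoid" where
  "schur_multiplier G = cohomology2 G complex_units"

definition is_complement :: "('a, 'b) monoid_scheme \<Rightarrow> 'a set \<Rightarrow> 'a set \<Rightarrow> bool" where
  "is_complement G N H \<longleftrightarrow>
     subgroup H G \<and> N \<inter> H = {\<one>\<^bsub>G\<^esub>} \<and> N <#>\<^bsub>G\<^esub> H = carrier G"

end

theory Submission
  imports Defs "HOL-Algebra.Group_Action" "HOL-Algebra.Multiplicative_Group"
begin

text \<open>Let \<open>n\<close> be the exponent of \<open>G\<close>, let \<open>f\<close> be a 2-cocycle, let \<open>E\<close> be the central extension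
  of \<open>G\<close> by the scalars with factor set \<open>f\<close>, and let \<open>M\<close> be the preimage of \<open>N\<close> in \<open>E\<close>.
  The \<open>n\<close>-th power of an element of \<open>E\<close> is a scalar. If \<open>x \<mapsto> x^n\<close> is a homomorphism on \<open>M\<close>,
  then it is invariant under conjugation by \<open>E\<close>, and applying it to coset representatives shows
  that \<open>f ^ n\<close> is cohomologous to the inflation of a cocycle \<open>\<gamma>\<close> of \<open>G / N\<close>. In case (c), \<open>\<gamma>\<close> is
  a coboundary; in case (d), choosing the representatives in \<open>H\<close> makes \<open>\<gamma>\<close> the \<open>n\<close>-th power of
  the restriction of \<open>f\<close> to \<open>H\<close>.

  For \<open>p = 2\<close>, \<open>M\<close> has class at most two and \<open>(x y)^n = [y,x]^(n(n-1)/2) x^n y^n\<close>; here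
  \<open>[y,x]^(n/2) = 1\<close>, since otherwise \<open>[y,x]\<close> has order \<open>n\<close> and the images of \<open>x\<close> and \<open>y\<close> generate
  a direct product of two cyclic groups of order \<open>n\<close>.

  For odd \<open>p\<close> and \<open>n = p^e\<close>, let \<open>M = L 0 \<ge> L 1 \<ge> \<dots>\<close> be the lower exponent-\<open>p\<close> central
  series modulo the scalars \<open>A\<close>. As \<open>N\<close> is powerful, induction on \<open>i\<close> shows that every element
  of \<open>L (i + 1)\<close> is modulo \<open>L (i + 2)\<close> the \<open>p\<close>-th power of an element of \<open>L i\<close>. So elements of
  \<open>L i\<close> are \<open>p^i\<close>-th powers modulo \<open>L (i + 1)\<close>, whence \<open>L e = L (e + 1) = \<dots> = A\<close> is central.
  With \<open>D i = [M, L i] \<le> L (i + 1)\<close> one gets \<open>(x y)^(p^i) = x^(p^i) y^(p^i)\<close> modulo \<open>D i\<close>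
  by induction on \<open>i\<close>, and \<open>D e = 1\<close>.\<close>

section \<open>Commutators and powers\<close>

text \<open>This has the shape of the elements generating \<open>derived\<close>. It puts the
  commutator on the left in \<open>x y = [x,y] (y x)\<close>, where a right coset can absorb
  it.\<close>

definition commutator :: "('a, 'b) monoid_scheme \<Rightarrow> 'a \<Rightarrow> 'a \<Rightarrow> 'a" where
  "commutator G x y = x \<otimes>\<^bsub>G\<^esub> y \<otimes>\<^bsub>G\<^esub> inv\<^bsub>G\<^esub> x \<otimes>\<^bsub>G\<^esub> inv\<^bsub>G\<^esub> y"

text \<open>Oddness of the prime enters here: the factor \<open>c ^ (n choose 2)\<close> of the
  class-two power formula disappears as soon as \<open>c ^ n = 1\<close>.\<close>

lemma odd_dvd_choose_two:
  fixes n :: nat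
  assumes "odd n"
  shows "n dvd n choose 2"
proof -
  from assms obtain k where "n = 2 * k + 1" by (rule oddE)
  then have "n choose 2 = n * k" by (simp add: choose_two)
  then show ?thesis by simp
qed

context group
begin

lemma subgroup_nat_pow_closed:
  "subgroup H G \<Longrightarrow> x \<in> H \<Longrightarrow> x [^] (n::nat) \<in> H"
  by (induction n) (auto simp: subgroup.one_closed subgroup.m_closed)

lemma commutator_closed [simp, intro]:
  "x \<in> carrier G \<Longrightarrow> y \<in> carrier G \<Longrightarrow> commutator G x y \<in> carrier G"
  by (simp add: commutator_def)

lemma mult_eq_commutator_mult:
  "x \<in> carrier G \<Longrightarrow> y \<in> carrier G \<Longrightarrow> x \<otimes> y = commutator G x y \<otimes> (y \<otimes> x)"
  by (simp add: commutator_def m_assoc inv_solve_left' inv_solve_right')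

lemma commutator_eq_one_iff:
  assumes "x \<in> carrier G" "y \<in> carrier G"
  shows "commutator G x y = \<one> \<longleftrightarrow> x \<otimes> y = y \<otimes> x"
  using assms mult_eq_commutator_mult[OF assms]
  by (metis commutator_closed l_one m_closed one_closed right_cancel)

lemma commutator_inv:
  assumes "x \<in> carrier G" "y \<in> carrier G"
  shows "inv (commutator G x y) = commutator G y x"
  using assms by (simp add: commutator_def inv_mult_group m_assoc)

lemma conj_eq_commutator_mult:
  assumes "x \<in> carrier G" "y \<in> carrier G"
  shows "x \<otimes> y \<otimes> inv x = commutator G x y \<otimes> y"
  using assms by (simp add: commutator_def m_assoc)

lemma conj_mult:
  assumes "g \<in> carrier G" "x \<in> carrier G" "y \<in> carrier G"
  shows "(g \<otimes> x \<otimes> inv g) \<otimes> (g \<otimes> y \<otimes> inv g) = g \<otimes> (x \<otimes> y) \<otimes> inv g"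
proof -
  have "(g \<otimes> x \<otimes> inv g) \<otimes> (g \<otimes> y \<otimes> inv g) = g \<otimes> x \<otimes> (inv g \<otimes> g) \<otimes> y \<otimes> inv g"
    using assms by (simp only: m_assoc m_closed inv_closed)
  then show ?thesis using assms by (simp add: m_assoc)
qed

lemma conj_inv:
  assumes "g \<in> carrier G" "x \<in> carrier G"
  shows "inv (g \<otimes> x \<otimes> inv g) = g \<otimes> inv x \<otimes> inv g"
  using assms by (simp add: inv_mult_group m_assoc)

lemma conj_commutator:
  assumes "g \<in> carrier G" "x \<in> carrier G" "y \<in> carrier G"
  shows "commutator G (g \<otimes> x \<otimes> inv g) (g \<otimes> y \<otimes> inv g) = g \<otimes> commutator G x y \<otimes> inv g"
  using assms by (simp only: commutator_def conj_inv conj_mult m_closed inv_closed)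

lemma conj_pow:
  assumes "x \<in> carrier G" "y \<in> carrier G"
  shows "(x \<otimes> y \<otimes> inv x) [^] (n::nat) = x \<otimes> y [^] n \<otimes> inv x"
  using assms by (induction n) (simp_all add: conj_mult)

text \<open>Here \<open>c\<close> is the commutator \<open>[b,a]\<close>. Moving \<open>a\<close> to
  the left past one factor \<open>b\<close> costs one \<open>c\<close>, and these factors collect
  because \<open>c\<close> commutes with \<open>b\<close>.\<close>

lemma class_two_pow_commute:
  assumes a: "a \<in> carrier G" and b: "b \<in> carrier G" and c: "c \<in> carrier G"
    and cb: "c \<otimes> b = b \<otimes> c" and ba: "b \<otimes> a = c \<otimes> (a \<otimes> b)"
  shows "b [^] (n::nat) \<otimes> a = c [^] n \<otimes> (a \<otimes> b [^] n)"
proof (induction n)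
  case (Suc n)
  have "b [^] Suc n \<otimes> a = b [^] n \<otimes> (b \<otimes> a)" using a b by (simp add: m_assoc)
  also have "\<dots> = b [^] n \<otimes> c \<otimes> a \<otimes> b" using a b c by (simp add: ba m_assoc)
  also have "b [^] n \<otimes> c = c \<otimes> b [^] n" using group_commutes_pow[OF cb[symmetric] b c] .
  also have "c \<otimes> b [^] n \<otimes> a \<otimes> b = c \<otimes> (b [^] n \<otimes> a) \<otimes> b" using a b c by (simp add: m_assoc)
  also have "\<dots> = c [^] Suc n \<otimes> (a \<otimes> b [^] Suc n)"
    using a b c unfolding Suc nat_pow_Suc2[OF c] by (simp add: m_assoc)
  finally show ?case .
qed (use a in simp)

text \<open>Moving the next \<open>a\<close> past \<open>b ^ n\<close> contributes
  \<open>c ^ n\<close>, and 0 + 1 + ... + (n - 1) is \<open>n choose 2\<close>.\<close>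

lemma class_two_pow_mult:
  assumes a: "a \<in> carrier G" and b: "b \<in> carrier G" and c: "c \<in> carrier G"
    and ca: "c \<otimes> a = a \<otimes> c" and cb: "c \<otimes> b = b \<otimes> c" and ba: "b \<otimes> a = c \<otimes> (a \<otimes> b)"
  shows "(a \<otimes> b) [^] (n::nat) = c [^] (n choose 2) \<otimes> (a [^] n \<otimes> b [^] n)"
proof (induction n)
  case 0
  then show ?case using a b by (simp add: numeral_2_eq_2)
next
  case (Suc n)
  have ch: "Suc n choose 2 = (n choose 2) + n" by (simp add: numeral_2_eq_2)
  have "(a \<otimes> b) [^] Suc n = c [^] (n choose 2) \<otimes> (a [^] n \<otimes> (b [^] n \<otimes> a) \<otimes> b)"
    using a b c by (simp add: Suc m_assoc)
  also have "a [^] n \<otimes> (b [^] n \<otimes> a) \<otimes> b = (a [^] n \<otimes> c [^] n) \<otimes> (a \<otimes> b [^] Suc n)"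
    unfolding class_two_pow_commute[OF a b c cb ba] using a b c by (simp add: m_assoc)
  also have "a [^] n \<otimes> c [^] n = c [^] n \<otimes> a [^] n"
    by (intro group_commutes_pow group_commutes_pow[symmetric] a c nat_pow_closed ca)
  also have "c [^] n \<otimes> a [^] n \<otimes> (a \<otimes> b [^] Suc n) = c [^] n \<otimes> (a [^] Suc n \<otimes> b [^] Suc n)"
    using a b c by (simp add: m_assoc)
  finally show ?case using a b c
    by (simp add: ch nat_pow_mult[symmetric] m_assoc)
qed

end

lemma (in group_hom) hom_commutator:
  "x \<in> carrier G \<Longrightarrow> y \<in> carrier G \<Longrightarrow> h (commutator G x y) = commutator H (h x) (h y)"
  by (simp add: commutator_def)

section \<open>Power formulas modulo a normal subgroup\<close>

context normal
begin

lemma group_hom_rcos: "group_hom G (G Mod H) (\<lambda>x. H #> x)"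
  by (simp add: group_hom_def group_hom_axioms_def is_group factorgroup_is_group r_coset_hom_Mod)

lemma rcos_eq_one_iff: "x \<in> carrier G \<Longrightarrow> H #> x = H \<longleftrightarrow> x \<in> H"
  by (metis coset_join1 coset_join2 is_subgroup subset)

lemma rcos_eqD:
  assumes "x \<in> carrier G" "y \<in> carrier G" "H #> x = H #> y"
  shows "\<exists>h \<in> H. x = h \<otimes> y"
  using assms rcos_self[of x] by (auto simp: r_coset_def)

lemma rcos_mult_left: "h \<in> H \<Longrightarrow> x \<in> carrier G \<Longrightarrow> H #> (h \<otimes> x) = H #> x"
  by (metis coset_join2 coset_mult_assoc is_subgroup mem_carrier subset)

text \<open>This is the class-two formula in the quotient by \<open>H\<close>: there
  \<open>[b,a]\<close> commutes with \<open>a\<close> and \<open>b\<close>, and its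
  \<open>n\<close>-th power is trivial, hence also its power \<open>n choose 2\<close>.\<close>

lemma rcos_pow_mult:
  assumes a: "a \<in> carrier G" and b: "b \<in> carrier G" and n: "odd n"
    and 1: "commutator G (commutator G b a) a \<in> H" "commutator G (commutator G b a) b \<in> H"
    and 2: "commutator G b a [^] (n::nat) \<in> H"
  shows "H #> ((a \<otimes> b) [^] n) = H #> (a [^] n \<otimes> b [^] n)"
proof -
  interpret q: group_hom G "G Mod H" "\<lambda>x. H #> x" by (rule group_hom_rcos)
  let ?Q = "G Mod H"
  define c where "c = commutator G b a"
  have c: "c \<in> carrier G" using a b by (simp add: c_def)
  have "commutator ?Q (H #> c) (H #> a) = \<one>\<^bsub>?Q\<^esub>" "commutator ?Q (H #> c) (H #> b) = \<one>\<^bsub>?Q\<^esub>"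
    using a b c 1 by (simp_all flip: q.hom_commutator add: rcos_eq_one_iff c_def)
  then have ca: "(H #> c) \<otimes>\<^bsub>?Q\<^esub> (H #> a) = (H #> a) \<otimes>\<^bsub>?Q\<^esub> (H #> c)"
    and cb: "(H #> c) \<otimes>\<^bsub>?Q\<^esub> (H #> b) = (H #> b) \<otimes>\<^bsub>?Q\<^esub> (H #> c)"
    using a b c by (simp_all only: q.H.commutator_eq_one_iff q.hom_closed)
  have "b \<otimes> a = c \<otimes> (a \<otimes> b)"
    unfolding c_def by (rule mult_eq_commutator_mult[OF b a])
  then have ba: "(H #> b) \<otimes>\<^bsub>?Q\<^esub> (H #> a) = (H #> c) \<otimes>\<^bsub>?Q\<^esub> ((H #> a) \<otimes>\<^bsub>?Q\<^esub> (H #> b))"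
    using a b c by (metis q.hom_mult m_closed)
  from n obtain k where k: "n choose 2 = n * k" using odd_dvd_choose_two by blast
  have "(H #> c) [^]\<^bsub>?Q\<^esub> n = \<one>\<^bsub>?Q\<^esub>"
    using c 2 by (simp flip: q.hom_nat_pow add: rcos_eq_one_iff c_def)
  then have ck: "(H #> c) [^]\<^bsub>?Q\<^esub> (n choose 2) = \<one>\<^bsub>?Q\<^esub>"
    using c by (simp add: k q.H.nat_pow_pow[symmetric] q.hom_closed del: one_FactGroup)
  have "((H #> a) \<otimes>\<^bsub>?Q\<^esub> (H #> b)) [^]\<^bsub>?Q\<^esub> n = (H #> a) [^]\<^bsub>?Q\<^esub> n \<otimes>\<^bsub>?Q\<^esub> (H #> b) [^]\<^bsub>?Q\<^esub> n"
    using q.H.class_two_pow_mult[OF q.hom_closed[OF a] q.hom_closed[OF b] q.hom_closed[OF c] ca cb ba, of n]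
    unfolding ck using a b by (simp add: q.hom_closed del: mult_FactGroup one_FactGroup)
  then show ?thesis using a b
    by (simp flip: q.hom_nat_pow q.hom_mult del: mult_FactGroup)
qed

text \<open>Conjugation by \<open>g\<close> turns \<open>x\<close> into \<open>[g,x] x\<close>, so
  \<open>[g, x ^ n] x ^ n = ([g,x] x) ^ n\<close>. The preceding lemma splits the right side modulo
  \<open>H\<close>, with \<open>d\<close> as the commutator of the two factors, and
  \<open>x ^ n\<close> cancels.\<close>

lemma rcos_commutator_pow:
  assumes g: "g \<in> carrier G" and x: "x \<in> carrier G" and n: "odd n"
    and d: "d = commutator G x (commutator G g x)"
    and 1: "commutator G d x \<in> H" "commutator G d (commutator G g x) \<in> H"
    and 2: "d [^] (n::nat) \<in> H"
  shows "H #> commutator G g (x [^] n) = H #> (commutator G g x [^] n)"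
proof -
  interpret q: group_hom G "G Mod H" "\<lambda>x. H #> x" by (rule group_hom_rcos)
  let ?c = "commutator G g x"
  have c: "?c \<in> carrier G" using g x by simp
  have "H #> (commutator G g (x [^] n) \<otimes> x [^] n) = H #> (?c [^] n \<otimes> x [^] n)"
    using rcos_pow_mult[OF c x n] 1 2 d g x
    by (simp flip: conj_eq_commutator_mult add: conj_pow)
  then show ?thesis using g x c
    by (simp del: mult_FactGroup add: q.hom_closed)
qed

end

section \<open>Central extensions of powerful groups\<close>

text \<open>\<open>G\<close> plays the part of the preimage \<open>M\<close> and \<open>A\<close>
  that of the scalars, so \<open>G\<close> is infinite in the application.\<close>

locale odd_central_ext = group +
  fixes A :: "'a set" and p :: nat
  assumes A_subgroup: "subgroup A G"
    and A_central: "\<And>a g. a \<in> A \<Longrightarrow> g \<in> carrier G \<Longrightarrow> a \<otimes> g = g \<otimes> a"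
    and p_odd: "odd p"
begin

text \<open>These are the groups \<open>L i\<close>. With \<open>A\<close> among the generators they
  are the preimages of the lower exponent-\<open>p\<close> central series of
  \<open>G / A\<close>.\<close>

primrec pseries :: "nat \<Rightarrow> 'a set" where
  "pseries 0 = carrier G"
| "pseries (Suc i) = generate G ((\<lambda>x. x [^] p) ` pseries i \<union>
     (\<Union>g \<in> carrier G. commutator G g ` pseries i) \<union> A)"

declare pseries.simps(2) [simp del]

lemma A_subset: "A \<subseteq> carrier G"
  using A_subgroup by (rule subgroup.subset)

lemma pseries_subgroup: "subgroup (pseries i) G"
proof (induction i)
  case (Suc i)
  then have "pseries i \<subseteq> carrier G" by (rule subgroup.subset)
  with A_subset show ?case unfolding pseries.simps by (intro generate_is_subgroup) auto
qed (simp add: subgroup_self)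

lemma pseries_carrier: "x \<in> pseries i \<Longrightarrow> x \<in> carrier G"
  using pseries_subgroup subgroup.mem_carrier by fast

lemma A_subset_pseries: "A \<subseteq> pseries i"
  using A_subset by (cases i) (auto simp: pseries.simps intro: generate.incl)

lemma pseries_pow: "x \<in> pseries i \<Longrightarrow> x [^] p \<in> pseries (Suc i)"
  by (auto simp: pseries.simps intro: generate.incl)

lemma pseries_commutator_right:
  "x \<in> pseries i \<Longrightarrow> g \<in> carrier G \<Longrightarrow> commutator G g x \<in> pseries (Suc i)"
  by (auto simp: pseries.simps intro!: generate.incl)

lemma pseries_commutator_left:
  assumes "x \<in> pseries i" "g \<in> carrier G"
  shows "commutator G x g \<in> pseries (Suc i)"
  using subgroup.m_inv_closed[OF pseries_subgroup pseries_commutator_right[OF assms]]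
    assms pseries_carrier by (simp add: commutator_inv)

lemma pseries_Suc_subset: "pseries (Suc i) \<subseteq> pseries i"
proof (induction i)
  case 0
  show ?case using pseries_carrier by auto
next
  case (Suc i)
  then show ?case
    unfolding pseries.simps(2)[of "Suc i"]
    by (subst pseries.simps(2)) (intro mono_generate; blast)
qed

lemma pseries_normal: "pseries i \<lhd> G"
proof (cases i)
  case (Suc j)
  show ?thesis
  proof (rule normal_invI[OF pseries_subgroup])
    fix x g
    assume x: "x \<in> pseries i" and g: "g \<in> carrier G"
    then have "commutator G g x \<in> pseries i"
      unfolding Suc using pseries_Suc_subset by (blast intro: pseries_commutator_right)
    then show "g \<otimes> x \<otimes> inv g \<in> pseries i"
      using x g pseries_carrier pseries_subgroup
      by (simp add: conj_eq_commutator_mult subgroup.m_closed)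
  qed
qed (simp add: normal_self)

text \<open>For \<open>x\<close>, \<open>y\<close> in \<open>L i\<close> the commutator
  \<open>[y,x]\<close> lies in \<open>L (i + 1)\<close>, so its \<open>p\<close>-th power and its
  commutators lie in \<open>L (i + 2)\<close>.\<close>

lemma pseries_pow_mult:
  assumes "x \<in> pseries i" "y \<in> pseries i"
  shows "pseries (Suc (Suc i)) #> ((x \<otimes> y) [^] p) = pseries (Suc (Suc i)) #> (x [^] p \<otimes> y [^] p)"
  using assms pseries_carrier p_odd
  by (intro normal.rcos_pow_mult[OF pseries_normal])
    (auto intro: pseries_commutator_left pseries_pow)

text \<open>The elements that are \<open>p\<close>-th powers from \<open>L i\<close> modulo
  \<open>L (i + 2)\<close>. The aim is that they include all of \<open>L (i + 1)\<close>; since they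
  form a subgroup, only generators have to be tested.\<close>

definition pow_reps :: "nat \<Rightarrow> 'a set" where
  "pow_reps i = {y \<in> carrier G. \<exists>x \<in> pseries i.
     pseries (Suc (Suc i)) #> y = pseries (Suc (Suc i)) #> (x [^] p)}"

lemma pow_repsI:
  assumes "y \<in> carrier G" "x \<in> pseries i"
    "pseries (Suc (Suc i)) #> y = pseries (Suc (Suc i)) #> (x [^] p)"
  shows "y \<in> pow_reps i"
  using assms by (auto simp: pow_reps_def)

lemma pow_repsE:
  assumes "y \<in> pow_reps i"
  obtains x where "y \<in> carrier G" "x \<in> pseries i" "x \<in> carrier G"
    "pseries (Suc (Suc i)) #> y = pseries (Suc (Suc i)) #> (x [^] p)"
  using assms pseries_carrier unfolding pow_reps_def by blast

text \<open>By \<open>pseries_pow_mult\<close>, taking \<open>p\<close>-th powers is multiplicative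
  on \<open>L i\<close> modulo \<open>L (i + 2)\<close>, so its image is closed under
  products.\<close>

lemma pow_reps_subgroup: "subgroup (pow_reps i) G"
proof -
  let ?D = "pseries (Suc (Suc i))"
  interpret D: normal ?D G by (rule pseries_normal)
  interpret q: group_hom G "G Mod ?D" "\<lambda>x. ?D #> x" by (rule D.group_hom_rcos)
  show ?thesis
  proof (rule subgroupI)
    show "pow_reps i \<subseteq> carrier G" by (auto elim: pow_repsE)
    have "\<one> \<in> pow_reps i"
      using subgroup.one_closed[OF pseries_subgroup] by (intro pow_repsI[of _ \<one>]) simp_all
    then show "pow_reps i \<noteq> {}" by blast
  next
    fix y assume "y \<in> pow_reps i"
    then obtain x where y: "y \<in> carrier G" and x: "x \<in> pseries i" "x \<in> carrier G"
      and eq: "?D #> y = ?D #> (x [^] p)" by (rule pow_repsE)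
    have "?D #> inv y = ?D #> inv (x [^] p)"
      unfolding q.hom_inv[OF y] q.hom_inv[OF nat_pow_closed[OF x(2)]] eq ..
    also have "inv (x [^] p) = inv x [^] p" using x by (simp add: nat_pow_inv)
    finally show "inv y \<in> pow_reps i"
      using y x subgroup.m_inv_closed[OF pseries_subgroup] by (intro pow_repsI) auto
  next
    fix y y' assume y_in: "y \<in> pow_reps i" "y' \<in> pow_reps i"
    obtain x where y: "y \<in> carrier G" and x: "x \<in> pseries i" "x \<in> carrier G"
      and eq: "?D #> y = ?D #> (x [^] p)" using y_in(1) by (rule pow_repsE)
    obtain x' where y': "y' \<in> carrier G" and x': "x' \<in> pseries i" "x' \<in> carrier G"
      and eq': "?D #> y' = ?D #> (x' [^] p)" using y_in(2) by (rule pow_repsE)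
    have "?D #> (y \<otimes> y') = ?D #> (x [^] p \<otimes> x' [^] p)"
      unfolding q.hom_mult[OF y y'] q.hom_mult[OF nat_pow_closed[OF x(2)] nat_pow_closed[OF x'(2)]]
        eq eq' ..
    also have "\<dots> = ?D #> ((x \<otimes> x') [^] p)" by (rule pseries_pow_mult[symmetric, OF x(1) x'(1)])
    finally show "y \<otimes> y' \<in> pow_reps i"
      using y y' by (intro pow_repsI[OF _ subgroup.m_closed[OF pseries_subgroup x(1) x'(1)]]) auto
  qed
qed

lemma pow_in_pow_reps: "x \<in> pseries i \<Longrightarrow> x [^] p \<in> pow_reps i"
  by (auto simp: pow_reps_def pseries_carrier)

lemma pseries_in_pow_reps:
  assumes "x \<in> pseries (Suc (Suc i))"
  shows "x \<in> pow_reps i"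
proof -
  interpret D: normal "pseries (Suc (Suc i))" G by (rule pseries_normal)
  have "\<one> \<in> pseries i" using pseries_subgroup subgroup.one_closed by blast
  moreover have "pseries (Suc (Suc i)) #> x = pseries (Suc (Suc i)) #> (\<one> [^] p)"
    using assms D.rcos_eq_one_iff[OF pseries_carrier[OF assms]]
    by (simp add: coset_mult_one[OF D.subset])
  ultimately show ?thesis
    using assms pseries_carrier unfolding pow_reps_def by blast
qed

lemma A_subset_pow_reps: "A \<subseteq> pow_reps i"
  using A_subset_pseries pseries_in_pow_reps by blast

text \<open>The correction term \<open>[x,[g,x]]\<close> lies in \<open>L (i + 2)\<close>, hence its
  \<open>p\<close>-th power and commutators lie in \<open>L (i + 3)\<close>. This precision is one
  level finer than that of \<open>pow_reps i\<close>, as the induction below requires.\<close>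

lemma commutator_pow_cong:
  assumes x: "x \<in> pseries i" and g: "g \<in> carrier G"
  shows "pseries (Suc (Suc (Suc i))) #> commutator G g (x [^] p) =
    pseries (Suc (Suc (Suc i))) #> (commutator G g x [^] p)"
proof -
  have c: "commutator G g x \<in> pseries (Suc i)" using assms by (rule pseries_commutator_right)
  then have "commutator G x (commutator G g x) \<in> pseries (Suc (Suc i))"
    using x pseries_carrier by (blast intro: pseries_commutator_right)
  with x g c pseries_carrier show ?thesis
    by (intro normal.rcos_commutator_pow[OF pseries_normal _ _ p_odd refl])
      (auto intro: pseries_commutator_left pseries_pow)
qed

end

text \<open>All conditions concern \<open>G / A\<close>: \<open>powerful\<close> is its
  powerfulness, \<open>pow_in_A\<close> bounds its exponent by \<open>p ^ e\<close>, and
  \<open>Z\<close> is an ascending central series from \<open>A\<close> to \<open>G\<close> with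
  factors of exponent dividing \<open>p\<close>, which provides nilpotency.\<close>

locale odd_powerful_central_ext = odd_central_ext +
  fixes e :: nat and Z :: "nat \<Rightarrow> 'a set" and r :: nat
  assumes powerful: "\<And>g x. g \<in> carrier G \<Longrightarrow> x \<in> carrier G \<Longrightarrow>
      commutator G g x \<in> generate G ((\<lambda>x. x [^] p) ` carrier G \<union> A)"
    and pow_in_A: "\<And>x. x \<in> carrier G \<Longrightarrow> x [^] (p ^ e) \<in> A"
    and Z_0: "Z 0 \<subseteq> A" and Z_r: "carrier G \<subseteq> Z r"
    and Z_subgroup: "\<And>j. subgroup (Z j) G" and A_Z: "\<And>j. A \<subseteq> Z j"
    and Z_pow: "\<And>j x. x \<in> Z (Suc j) \<Longrightarrow> x [^] p \<in> Z j"
    and Z_commutator: "\<And>j g x. g \<in> carrier G \<Longrightarrow> x \<in> Z (Suc j) \<Longrightarrow> commutator G g x \<in> Z j"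
begin

text \<open>At the start, powerfulness handles the commutators. In the step, \<open>y\<close> in
  \<open>L (i + 1)\<close> is \<open>z x ^ p\<close> with \<open>z\<close> in
  \<open>L (i + 2)\<close> and \<open>x\<close> in \<open>L i\<close>; modulo
  \<open>L (i + 3)\<close> the factor \<open>z\<close> is central, so \<open>[g,y]\<close> agrees
  with \<open>[g, x ^ p]\<close> and thus with \<open>[g,x] ^ p\<close>, where \<open>[g,x]\<close>
  lies in \<open>L (i + 1)\<close>.\<close>

lemma pseries_Suc_subset_pow_reps: "pseries (Suc i) \<subseteq> pow_reps i"
proof (induction i)
  case 0
  have sub: "generate G ((\<lambda>x. x [^] p) ` carrier G \<union> A) \<subseteq> pow_reps 0"
    using A_subset_pseries
    by (intro generate_subgroup_incl pow_reps_subgroup)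
      (auto intro: pow_in_pow_reps[of _ 0, simplified] pseries_in_pow_reps)
  show ?case
    unfolding pseries.simps using A_subset_pseries
    by (intro generate_subgroup_incl pow_reps_subgroup)
      (auto intro: pow_in_pow_reps[of _ 0, simplified] pseries_in_pow_reps
        powerful[THEN subsetD[OF sub]])
next
  case (Suc i)
  let ?D = "pseries (Suc (Suc (Suc i)))"
  interpret D: normal ?D G by (rule pseries_normal)
  interpret q: group_hom G "G Mod ?D" "\<lambda>x. ?D #> x" by (rule D.group_hom_rcos)
  have "commutator G g y \<in> pow_reps (Suc i)"
    if g: "g \<in> carrier G" and y: "y \<in> pseries (Suc i)" for g y
  proof -
    from Suc y have "y \<in> pow_reps i" by blast
    then obtain x where x: "x \<in> pseries i"
      and eq: "pseries (Suc (Suc i)) #> y = pseries (Suc (Suc i)) #> (x [^] p)"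
      by (auto simp: pow_reps_def)
    have x': "x \<in> carrier G" and y': "y \<in> carrier G" using x y pseries_carrier by auto
    obtain z where z: "z \<in> pseries (Suc (Suc i))" and yz: "y = z \<otimes> x [^] p"
      using normal.rcos_eqD[OF pseries_normal y' _ eq] x' by auto
    have z': "z \<in> carrier G" using z pseries_carrier by auto
    \<comment> \<open>\<open>[g,z]\<close> lies in \<open>L (i + 3)\<close>, the subgroup factored
      out.\<close>
    have gz: "?D #> (g \<otimes> z) = ?D #> (z \<otimes> g)"
      using mult_eq_commutator_mult[OF g z'] g z'
        D.rcos_mult_left[OF pseries_commutator_right[OF z g], of "z \<otimes> g"] by simp
    have "g \<otimes> y = (g \<otimes> z) \<otimes> x [^] p" using g z' x' by (simp add: yz m_assoc)
    then have "?D #> (g \<otimes> y) = ?D #> (z \<otimes> g \<otimes> x [^] p)"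
      using q.hom_mult[of "g \<otimes> z" "x [^] p"] q.hom_mult[of "z \<otimes> g" "x [^] p"] gz g z' x' by simp
    moreover have "commutator G g y = (g \<otimes> y) \<otimes> inv (y \<otimes> g)"
      using g y' by (simp add: commutator_def inv_mult_group m_assoc)
    ultimately have "?D #> commutator G g y = ?D #> (z \<otimes> g \<otimes> x [^] p \<otimes> inv (y \<otimes> g))"
      using q.hom_mult[of "g \<otimes> y" "inv (y \<otimes> g)"]
        q.hom_mult[of "z \<otimes> g \<otimes> x [^] p" "inv (y \<otimes> g)"] g y' z' x' by simp
    \<comment> \<open>What remains is a conjugate by \<open>z\<close>, and conjugation by
      \<open>z\<close> is trivial modulo \<open>L (i + 3)\<close>.\<close>
    also have "z \<otimes> g \<otimes> x [^] p \<otimes> inv (y \<otimes> g) = z \<otimes> commutator G g (x [^] p) \<otimes> inv z"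
      using g z' x' by (simp add: yz commutator_def inv_mult_group m_assoc)
    also have "\<dots> = commutator G z (commutator G g (x [^] p)) \<otimes> commutator G g (x [^] p)"
      using g z' x' by (intro conj_eq_commutator_mult) auto
    also have "?D #> \<dots> = ?D #> commutator G g (x [^] p)"
      using g x' z by (intro D.rcos_mult_left pseries_commutator_left) auto
    also have "\<dots> = ?D #> (commutator G g x [^] p)" by (rule commutator_pow_cong[OF x g])
    finally show ?thesis
      unfolding pow_reps_def using pseries_commutator_right[OF x g] g y' by auto
  qed
  then show ?case
    unfolding pseries.simps(2)[of "Suc i"] using A_subset_pow_reps
    by (intro generate_subgroup_incl pow_reps_subgroup) (auto intro: pow_in_pow_reps)
qed

text \<open>Modulo \<open>L (i + 2)\<close>, \<open>y\<close> is \<open>x ^ p\<close> with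
  \<open>x\<close> in \<open>L i\<close>. By induction \<open>x = v w ^ (p ^ i)\<close> with
  \<open>v\<close> in \<open>L (i + 1)\<close>; raising this to the power \<open>p\<close> is
  multiplicative modulo \<open>L (i + 2)\<close> and kills \<open>v\<close>.\<close>

lemma pseries_pow_rep:
  "y \<in> pseries i \<Longrightarrow> \<exists>x \<in> carrier G. pseries (Suc i) #> y = pseries (Suc i) #> (x [^] (p ^ i))"
proof (induction i arbitrary: y)
  case 0
  then show ?case by auto
next
  case (Suc i)
  let ?D = "pseries (Suc (Suc i))"
  interpret D: normal ?D G by (rule pseries_normal)
  from Suc.prems have "y \<in> pow_reps i" using pseries_Suc_subset_pow_reps by blast
  then obtain x where x: "x \<in> pseries i" and yx: "?D #> y = ?D #> (x [^] p)"
    by (auto simp: pow_reps_def)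
  from Suc.IH[OF x] obtain w where w: "w \<in> carrier G"
    and eq: "pseries (Suc i) #> x = pseries (Suc i) #> (w [^] (p ^ i))" by auto
  have x': "x \<in> carrier G" using x pseries_carrier by auto
  obtain v where v: "v \<in> pseries (Suc i)" and xv: "x = v \<otimes> w [^] (p ^ i)"
    using normal.rcos_eqD[OF pseries_normal x' _ eq] w by auto
  have v': "v \<in> carrier G" using v pseries_carrier by auto
  have vi: "v \<in> pseries i" using v pseries_Suc_subset by auto
  \<comment> \<open>Membership in \<open>L i\<close> is what allows \<open>pseries_pow_mult\<close>
    to be applied to the product of \<open>v\<close> and this power.\<close>
  have "w [^] (p ^ i) = inv v \<otimes> x" using xv v' w x' by (simp add: inv_solve_left)
  then have wi: "w [^] (p ^ i) \<in> pseries i"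
    using vi x pseries_subgroup[of i] by (simp add: subgroup.m_closed subgroup.m_inv_closed)
  have "?D #> y = ?D #> (v [^] p \<otimes> (w [^] (p ^ i)) [^] p)"
    unfolding yx xv by (rule pseries_pow_mult[OF vi wi])
  also have "\<dots> = ?D #> ((w [^] (p ^ i)) [^] p)"
    using w v by (intro D.rcos_mult_left pseries_pow) auto
  also have "(w [^] (p ^ i)) [^] p = w [^] (p ^ Suc i)"
    using w by (simp add: nat_pow_pow mult.commute)
  finally show ?case using w by blast
qed

text \<open>Modulo \<open>L (e + 1)\<close>, an element of \<open>L e\<close> is a
  \<open>p ^ e\<close>-th power, which lies in \<open>A\<close> and hence in
  \<open>L (e + 1)\<close>. Thus two consecutive terms agree, and each term determines the
  next.\<close>

lemma pseries_stable: "pseries (e + j) = pseries e"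
proof -
  have "pseries e \<subseteq> pseries (Suc e)"
  proof
    fix y assume y: "y \<in> pseries e"
    then obtain x where x: "x \<in> carrier G" "pseries (Suc e) #> y = pseries (Suc e) #> (x [^] (p ^ e))"
      using pseries_pow_rep by blast
    then have "pseries (Suc e) #> y = pseries (Suc e)"
      using pow_in_A A_subset_pseries pseries_subgroup
      by (metis coset_join2 nat_pow_closed subsetD)
    then show "y \<in> pseries (Suc e)"
      using y pseries_carrier normal.rcos_eq_one_iff[OF pseries_normal] by blast
  qed
  then have eq: "pseries (Suc e) = pseries e" using pseries_Suc_subset by blast
  show ?thesis
  proof (induction j)
    case (Suc j)
    have "pseries (e + Suc j) = pseries (Suc e)"
      unfolding add_Suc_right by (simp only: pseries.simps(2) Suc)
    with eq show ?case by simp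
  qed simp
qed

text \<open>The usual comparison of a descending with an ascending central series: each descent in
  \<open>L\<close> matches one descent in \<open>Z\<close>.\<close>

lemma pseries_subset_Z: "j \<le> r \<Longrightarrow> pseries j \<subseteq> Z (r - j)"
proof (induction j)
  case 0
  then show ?case using Z_r by simp
next
  case (Suc j)
  then have "pseries j \<subseteq> Z (Suc (r - Suc j))" by (simp add: Suc_diff_Suc)
  then show ?case
    unfolding pseries.simps using A_Z Z_pow Z_commutator
    by (intro generate_subgroup_incl Z_subgroup) auto
qed

text \<open>By stability \<open>L e = L (e + r)\<close>, which lies in \<open>L r\<close> and so in
  \<open>Z 0\<close> and in \<open>A\<close>.\<close>

lemma pseries_central:
  assumes "x \<in> pseries e" "g \<in> carrier G"
  shows "commutator G g x = \<one>"
proof -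
  have "pseries r \<subseteq> A" using pseries_subset_Z[of r] Z_0 by auto
  moreover have "pseries (e + r) \<subseteq> pseries r"
    by (induction e) (use pseries_Suc_subset in auto)
  ultimately have "x \<in> A" using assms(1) pseries_stable by auto
  then show ?thesis
    using assms(2) A_central A_subset by (subst commutator_eq_one_iff) auto
qed

text \<open>These are the groups \<open>D i\<close>. Unlike in \<open>pseries\<close>,
  \<open>A\<close> is not among the generators: a congruence modulo \<open>dseries e\<close> has to
  become an equality.\<close>

definition dseries :: "nat \<Rightarrow> 'a set" where
  "dseries i = generate G (\<Union>g \<in> carrier G. commutator G g ` pseries i)"

lemma dseries_subgroup: "subgroup (dseries i) G"
  unfolding dseries_def using pseries_carrier by (intro generate_is_subgroup) auto

lemma dseries_subset: "dseries i \<subseteq> pseries (Suc i)"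
  unfolding dseries_def using pseries_commutator_right
  by (intro generate_subgroup_incl pseries_subgroup) auto

lemma dseries_pseries: "x \<in> dseries i \<Longrightarrow> x \<in> pseries (Suc i)"
  using dseries_subset by blast

lemma dseries_Suc_pseries: "x \<in> dseries (Suc i) \<Longrightarrow> x \<in> pseries (Suc i)"
  using dseries_pseries pseries_Suc_subset by blast

lemma dseries_carrier: "x \<in> dseries i \<Longrightarrow> x \<in> carrier G"
  using dseries_pseries pseries_carrier by blast

lemma dseries_commutator_right:
  "x \<in> pseries i \<Longrightarrow> g \<in> carrier G \<Longrightarrow> commutator G g x \<in> dseries i"
  unfolding dseries_def by (auto intro!: generate.incl)

lemma dseries_commutator_left:
  assumes "x \<in> pseries i" "g \<in> carrier G"
  shows "commutator G x g \<in> dseries i"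
  using subgroup.m_inv_closed[OF dseries_subgroup dseries_commutator_right[OF assms]]
    assms pseries_carrier by (simp add: commutator_inv)

text \<open>The generating set is already closed under conjugation, because \<open>pseries i\<close>
  is normal.\<close>

lemma dseries_normal: "dseries i \<lhd> G"
  unfolding dseries_def
proof (rule normal_generateI)
  show "(\<Union>g \<in> carrier G. commutator G g ` pseries i) \<subseteq> carrier G" using pseries_carrier by auto
next
  fix h g assume "h \<in> (\<Union>g \<in> carrier G. commutator G g ` pseries i)" and g: "g \<in> carrier G"
  then obtain k x where k: "k \<in> carrier G" and x: "x \<in> pseries i" and h: "h = commutator G k x"
    by auto
  have x': "x \<in> carrier G" using x by (rule pseries_carrier)
  have "g \<otimes> h \<otimes> inv g = commutator G (g \<otimes> k \<otimes> inv g) (g \<otimes> x \<otimes> inv g)"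
    unfolding h using g k x' by (rule conj_commutator[symmetric])
  moreover have "g \<otimes> x \<otimes> inv g \<in> pseries i"
    using normal.inv_op_closed2[OF pseries_normal g x] .
  moreover have "g \<otimes> k \<otimes> inv g \<in> carrier G" using g k by simp
  ultimately show "g \<otimes> h \<otimes> inv g \<in> (\<Union>g \<in> carrier G. commutator G g ` pseries i)" by blast
qed

text \<open>As \<open>D i\<close> lies in \<open>L (i + 1)\<close>, it is central modulo
  \<open>D (i + 1)\<close>, so the elements of \<open>D i\<close> with \<open>p\<close>-th power in
  \<open>D (i + 1)\<close> form a subgroup. It contains each generator \<open>[g,x]\<close>, since
  \<open>[g,x] ^ p\<close> agrees with \<open>[g, x ^ p]\<close> modulo \<open>D (i + 1)\<close> and
  \<open>x ^ p\<close> lies in \<open>L (i + 1)\<close>.\<close>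

lemma dseries_pow: "d \<in> dseries i \<Longrightarrow> d [^] p \<in> dseries (Suc i)"
proof -
  let ?D = "dseries (Suc i)"
  interpret D: normal ?D G by (rule dseries_normal)
  interpret q: group_hom G "G Mod ?D" "\<lambda>x. ?D #> x" by (rule D.group_hom_rcos)
  let ?S = "{d \<in> dseries i. d [^] p \<in> ?D}"
  have comm: "commutator G d g \<in> ?D" "commutator G g d \<in> ?D"
    if "d \<in> pseries (Suc i)" "g \<in> carrier G" for d g
    using that by (auto intro: dseries_commutator_left dseries_commutator_right)
  have "subgroup ?S G"
  proof (rule subgroupI)
    show "?S \<subseteq> carrier G" using dseries_subgroup subgroup.subset by blast
    have "\<one> \<in> ?S" using dseries_subgroup by (auto simp: subgroup.one_closed)
    then show "?S \<noteq> {}" by blast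
  next
    fix d assume "d \<in> ?S"
    then show "inv d \<in> ?S"
      using dseries_carrier[of d i] subgroup.m_inv_closed[OF dseries_subgroup]
      by (simp add: nat_pow_inv)
  next
    fix d d' assume d: "d \<in> ?S" and d': "d' \<in> ?S"
    have dd: "d \<in> carrier G" "d' \<in> carrier G" "d \<in> pseries (Suc i)" "d' \<in> pseries (Suc i)"
      using d d' by (auto intro: dseries_carrier dseries_pseries)
    have c: "commutator G d' d \<in> ?D" using comm dd by auto
    have cp: "commutator G d' d \<in> pseries (Suc i)"
      using c by (rule dseries_Suc_pseries)
    have "?D #> ((d \<otimes> d') [^] p) = ?D #> (d [^] p \<otimes> d' [^] p)"
      using c dd
      by (intro D.rcos_pow_mult p_odd comm cp) (auto intro: subgroup_nat_pow_closed[OF dseries_subgroup])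
    also have "\<dots> = ?D" using d d' D.rcos_eq_one_iff[of "d [^] p \<otimes> d' [^] p"] dd by auto
    finally have "(d \<otimes> d') [^] p \<in> ?D" using dd D.rcos_eq_one_iff by auto
    then show "d \<otimes> d' \<in> ?S" using d d' subgroup.m_closed[OF dseries_subgroup] by simp
  qed
  moreover have "commutator G g x \<in> ?S" if g: "g \<in> carrier G" and x: "x \<in> pseries i" for g x
  proof -
    have c: "commutator G g x \<in> pseries (Suc i)" using pseries_commutator_right x g by blast
    have x': "x \<in> carrier G" using x pseries_carrier by auto
    have d: "commutator G x (commutator G g x) \<in> ?D" using comm c x' by auto
    have dp: "commutator G x (commutator G g x) \<in> pseries (Suc i)"
      using d by (rule dseries_Suc_pseries)
    have "?D #> commutator G g (x [^] p) = ?D #> (commutator G g x [^] p)"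
      using d dp g x' by (intro D.rcos_commutator_pow[OF _ _ _ refl] p_odd comm) (auto intro: subgroup_nat_pow_closed[OF dseries_subgroup])
    moreover have "commutator G g (x [^] p) \<in> ?D"
      using comm pseries_pow x g by auto
    ultimately have "commutator G g x [^] p \<in> ?D"
      using D.rcos_eq_one_iff g x' by (metis commutator_closed nat_pow_closed)
    then show ?thesis using dseries_commutator_right x g by auto
  qed
  ultimately have "dseries i \<subseteq> ?S"
    unfolding dseries_def[of i] by (intro generate_subgroup_incl) auto
  then show "d \<in> dseries i \<Longrightarrow> d [^] p \<in> dseries (Suc i)" by auto
qed

lemma pow_in_pseries: "x \<in> carrier G \<Longrightarrow> x [^] (p ^ i) \<in> pseries i"
proof (induction i)
  case (Suc i)
  then show ?case using pseries_pow[of "x [^] (p ^ i)" i]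
    by (simp add: nat_pow_pow mult.commute)
qed simp

text \<open>The induction hypothesis gives \<open>(x y) ^ (p ^ i) = d a b\<close> with
  \<open>d\<close> in \<open>D i\<close>; the \<open>p\<close>-th power of this is split modulo
  \<open>D (i + 1)\<close>, first at \<open>d\<close> and then between \<open>a\<close> and
  \<open>b\<close>.\<close>

lemma dseries_pow_mult:
  assumes x: "x \<in> carrier G" and y: "y \<in> carrier G"
  shows "dseries i #> ((x \<otimes> y) [^] (p ^ i)) = dseries i #> (x [^] (p ^ i) \<otimes> y [^] (p ^ i))"
proof (induction i)
  case (Suc i)
  let ?D = "dseries (Suc i)"
  interpret D: normal ?D G by (rule dseries_normal)
  interpret q: group_hom G "G Mod ?D" "\<lambda>x. ?D #> x" by (rule D.group_hom_rcos)
  let ?a = "x [^] (p ^ i)" and ?b = "y [^] (p ^ i)"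
  have ab: "?a \<in> pseries i" "?b \<in> pseries i" "?a \<in> carrier G" "?b \<in> carrier G"
    using x y pow_in_pseries by auto
  have comm: "commutator G d g \<in> ?D" if "d \<in> pseries (Suc i)" "g \<in> carrier G" for d g
    using that by (auto intro: dseries_commutator_left)
  obtain d where d: "d \<in> dseries i" and eq: "(x \<otimes> y) [^] (p ^ i) = d \<otimes> (?a \<otimes> ?b)"
    using normal.rcos_eqD[OF dseries_normal _ _ Suc] x y by auto
  have dp: "d \<in> pseries (Suc i)" and d': "d \<in> carrier G"
    using d by (auto intro: dseries_carrier dseries_pseries)
  have c: "commutator G (?a \<otimes> ?b) d \<in> ?D" using dp ab by (auto intro: dseries_commutator_right)
  then have cp: "commutator G (?a \<otimes> ?b) d \<in> pseries (Suc i)"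
    by (rule dseries_Suc_pseries)
  have e1: "?D #> ((x \<otimes> y) [^] (p ^ Suc i)) = ?D #> ((d \<otimes> (?a \<otimes> ?b)) [^] p)"
    using x y by (simp add: nat_pow_pow mult.commute flip: eq)
  \<comment> \<open>\<open>d\<close> lies in \<open>L (i + 1)\<close>, so its commutators lie in
    \<open>D (i + 1)\<close>.\<close>
  have e2: "?D #> ((d \<otimes> (?a \<otimes> ?b)) [^] p) = ?D #> (d [^] p \<otimes> (?a \<otimes> ?b) [^] p)"
    using ab d' c by (intro D.rcos_pow_mult p_odd comm cp) (auto intro: subgroup_nat_pow_closed[OF dseries_subgroup])
  have e3: "?D #> (d [^] p \<otimes> (?a \<otimes> ?b) [^] p) = ?D #> ((?a \<otimes> ?b) [^] p)"
    using ab d by (intro D.rcos_mult_left dseries_pow) auto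
  \<comment> \<open>\<open>[b,a]\<close> need not lie in \<open>D (i + 1)\<close>, but it lies in
    \<open>D i\<close>, so its \<open>p\<close>-th power and its commutators do.\<close>
  have e4: "?D #> ((?a \<otimes> ?b) [^] p) = ?D #> (?a [^] p \<otimes> ?b [^] p)"
  proof (rule D.rcos_pow_mult[OF ab(3,4) p_odd])
    have cd: "commutator G ?b ?a \<in> dseries i"
      using ab by (auto intro: dseries_commutator_right)
    then show "commutator G ?b ?a [^] p \<in> ?D" by (rule dseries_pow)
    have "commutator G ?b ?a \<in> pseries (Suc i)" using cd by (rule dseries_pseries)
    then show "commutator G (commutator G ?b ?a) ?a \<in> ?D"
      "commutator G (commutator G ?b ?a) ?b \<in> ?D"
      using ab comm by auto
  qed
  have "?a [^] p = x [^] (p ^ Suc i)" "?b [^] p = y [^] (p ^ Suc i)"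
    using x y by (simp_all add: nat_pow_pow mult.commute)
  with e1 e2 e3 e4 show ?case by (simp only:)
next
  case 0
  show ?case using x y by simp
qed

text \<open>Centrality of \<open>L e\<close> makes \<open>dseries e\<close> trivial, so the
  congruence at level \<open>e\<close> is an equality.\<close>

theorem pow_mult_distrib_of_powerful:
  assumes x: "x \<in> carrier G" and y: "y \<in> carrier G"
  shows "(x \<otimes> y) [^] (p ^ e) = x [^] (p ^ e) \<otimes> y [^] (p ^ e)"
proof -
  have "dseries e \<subseteq> {\<one>}"
    unfolding dseries_def
    by (intro generate_subgroup_incl triv_subgroup) (auto simp: pseries_central)
  moreover obtain d where d: "d \<in> dseries e" "(x \<otimes> y) [^] (p ^ e) = d \<otimes> (x [^] (p ^ e) \<otimes> y [^] (p ^ e))"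
    using normal.rcos_eqD[OF dseries_normal _ _ dseries_pow_mult[OF x y]] x y by auto
  ultimately have "d = \<one>" "(x \<otimes> y) [^] (p ^ e) = d \<otimes> (x [^] (p ^ e) \<otimes> y [^] (p ^ e))"
    by auto
  with x y show ?thesis by simp
qed

end

section \<open>Central series of finite p-groups\<close>

text \<open>Class equation: conjugacy classes have \<open>p\<close>-power size and their sizes add
  up to a multiple of \<open>p\<close>, so the class of the identity cannot be the only one of size
  one. A suitable power of the central element found in this way has order \<open>p\<close>.\<close>

lemma (in group) finite_p_group_central_element:
  assumes "prime p" and "finite_p_group p G" and nontriv: "carrier G \<noteq> {\<one>}"
  obtains x where "x \<in> carrier G" "x \<noteq> \<one>" "x [^] p = \<one>"
    "\<And>g. g \<in> carrier G \<Longrightarrow> g \<otimes> x = x \<otimes> g"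
proof -
  from assms(2) obtain n where fin: "finite (carrier G)" and ord: "order G = p ^ n"
    by (auto simp: finite_p_group_def)
  let ?\<phi> = "\<lambda>g. \<lambda>h \<in> carrier G. g \<otimes> h \<otimes> inv g"
  interpret act: group_action G "carrier G" ?\<phi> by (rule action_by_conjugation)
  let ?O = "orbits G (carrier G) ?\<phi>"
  have orb_card: "card (orbit G ?\<phi> x) = 1 \<or> p dvd card (orbit G ?\<phi> x)" if "x \<in> carrier G" for x
  proof -
    have "card (orbit G ?\<phi> x) dvd p ^ n"
      unfolding ord[symmetric] act.orbit_stabilizer_theorem[OF that, symmetric] by simp
    then obtain k where "card (orbit G ?\<phi> x) = p ^ k"
      using divides_primepow_nat[OF assms(1)] by auto
    then show ?thesis by (cases k) auto
  qed
  have in_orb: "x \<in> orbit G ?\<phi> x" if "x \<in> carrier G" for x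
    using act.orbit_refl[OF that] .
  have O_cover: "\<Union> ?O = carrier G" by (rule act.orbits_coverture)
  have O_fin: "finite ?O" by (rule finite_UnionD) (simp only: O_cover fin)
  have one_orb: "orbit G ?\<phi> \<one> = {\<one>}"
    using in_orb[OF one_closed] by (auto simp: orbit_def)
  have one_in: "{\<one>} \<in> ?O" using one_orb by (auto simp: orbits_def)
  have "card (\<Union> ?O) = (\<Sum>X \<in> ?O. card X)"
  proof (rule card_Union_disjoint)
    show "pairwise disjnt ?O"
      using act.disjoint_union by (auto simp: pairwise_def disjnt_def)
    show "finite X" if "X \<in> ?O" for X
      using finite_subset[OF Union_upper[OF that]] fin unfolding O_cover .
  qed
  then have sum: "order G = (\<Sum>X \<in> ?O. card X)" unfolding O_cover order_def .
  have "p dvd order G"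
  proof (cases n)
    case 0
    then have "card (carrier G) = 1" using ord by (simp add: order_def)
    then obtain a where "carrier G = {a}" by (rule card_1_singletonE)
    with nontriv one_closed show ?thesis by auto
  qed (simp add: ord)
  have "\<exists>X \<in> ?O. X \<noteq> {\<one>} \<and> card X = 1"
  proof (rule ccontr)
    assume "\<not> ?thesis"
    then have "p dvd (\<Sum>X \<in> ?O - {{\<one>}}. card X)"
      using orb_card by (intro dvd_sum) (auto simp: orbits_def)
    moreover have "order G = 1 + (\<Sum>X \<in> ?O - {{\<one>}}. card X)"
      unfolding sum by (subst sum.remove[OF O_fin one_in]) simp
    ultimately have "p dvd 1" using \<open>p dvd order G\<close> by (simp only: dvd_add_left_iff)
    with assms(1) show False by (simp add: prime_nat_iff)
  qed
  then obtain x where x: "x \<in> carrier G" "orbit G ?\<phi> x \<noteq> {\<one>}" "card (orbit G ?\<phi> x) = 1"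
    by (auto simp: orbits_def)
  from x(3) obtain y where "orbit G ?\<phi> x = {y}" by (rule card_1_singletonE)
  with in_orb[OF x(1)] have orb: "orbit G ?\<phi> x = {x}" by simp
  have central: "g \<otimes> x = x \<otimes> g" if g: "g \<in> carrier G" for g
  proof -
    have "g \<otimes> x \<otimes> inv g \<in> orbit G ?\<phi> x" using x g by (auto simp: orbit_def)
    then have "g \<otimes> x \<otimes> inv g = x" using orb by simp
    then show ?thesis using x g inv_solve_right[of x "g \<otimes> x" g] by simp
  qed
  have "x [^] (p ^ n) = \<one>" using x pow_order_eq_1 by (simp flip: ord)
  then have ex: "\<exists>m. x [^] (p ^ m) = \<one>" by blast
  \<comment> \<open>The order of \<open>x\<close> is \<open>p ^ m\<close>, so with
    \<open>m = Suc k\<close> the power \<open>x ^ (p ^ k)\<close> has order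
    \<open>p\<close>.\<close>
  define m where "m = (LEAST m. x [^] (p ^ m) = \<one>)"
  have m: "x [^] (p ^ m) = \<one>" unfolding m_def by (rule LeastI_ex[OF ex])
  have "m \<noteq> 0" using m x orb by (cases m) auto
  then obtain k where k: "m = Suc k" by (cases m) auto
  let ?y = "x [^] (p ^ k)"
  show thesis
  proof
    show "?y \<in> carrier G" using x by simp
    show "?y \<noteq> \<one>" using not_less_Least[of k "\<lambda>m. x [^] (p ^ m) = \<one>", folded m_def] k by simp
    show "?y [^] p = \<one>" using m k x by (simp add: nat_pow_pow mult.commute)
    show "g \<otimes> ?y = ?y \<otimes> g" if "g \<in> carrier G" for g
      using group_commutes_pow[OF central[OF that, symmetric] x(1) that] by simp
  qed
qed

text \<open>The subgroup \<open>Omega_1(Z(G))\<close>: in the abelian group \<open>Z(G)\<close> the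
  elements with trivial \<open>p\<close>-th power are closed under products.\<close>

definition omega_center :: "nat \<Rightarrow> ('a, 'b) monoid_scheme \<Rightarrow> 'a set" where
  "omega_center p G = {x \<in> carrier G. x [^]\<^bsub>G\<^esub> p = \<one>\<^bsub>G\<^esub> \<and>
     (\<forall>g \<in> carrier G. g \<otimes>\<^bsub>G\<^esub> x = x \<otimes>\<^bsub>G\<^esub> g)}"

lemma omega_centerD:
  assumes "x \<in> omega_center p G"
  shows "x \<in> carrier G" "x [^]\<^bsub>G\<^esub> p = \<one>\<^bsub>G\<^esub>"
    "g \<in> carrier G \<Longrightarrow> g \<otimes>\<^bsub>G\<^esub> x = x \<otimes>\<^bsub>G\<^esub> g"
  using assms by (auto simp: omega_center_def)

lemma (in group) omega_center_subgroup: "subgroup (omega_center p G) G"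
proof (rule subgroupI)
  show "omega_center p G \<subseteq> carrier G" by (auto simp: omega_center_def)
  have "\<one> \<in> omega_center p G" by (simp add: omega_center_def)
  then show "omega_center p G \<noteq> {}" by blast
next
  fix x assume x_in: "x \<in> omega_center p G"
  note x = omega_centerD(1,2)[OF x_in]
  have "g \<otimes> inv x = inv x \<otimes> g" if g: "g \<in> carrier G" for g
  proof -
    have "x \<otimes> (g \<otimes> inv x) = g \<otimes> x \<otimes> inv x"
      using omega_centerD(3)[OF x_in g] x g by (simp flip: m_assoc)
    also have "\<dots> = g" using x g by (simp add: m_assoc)
    finally show ?thesis using x g by (subst inv_solve_left) auto
  qed
  with x show "inv x \<in> omega_center p G" by (simp add: omega_center_def nat_pow_inv)
next
  fix x y assume x_in: "x \<in> omega_center p G" and y_in: "y \<in> omega_center p G"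
  note x = omega_centerD(1,2)[OF x_in] and y = omega_centerD(1,2)[OF y_in]
  have "g \<otimes> (x \<otimes> y) = (x \<otimes> y) \<otimes> g" if g: "g \<in> carrier G" for g
  proof -
    have "g \<otimes> (x \<otimes> y) = x \<otimes> (g \<otimes> y)"
      using omega_centerD(3)[OF x_in g] x y g by (simp flip: m_assoc)
    then show ?thesis
      using omega_centerD(3)[OF y_in g] x y g by (simp add: m_assoc)
  qed
  moreover have "(x \<otimes> y) [^] p = \<one>"
    using pow_mult_distrib[OF omega_centerD(3)[OF y_in x(1)] x(1) y(1)] x y by simp
  ultimately show "x \<otimes> y \<in> omega_center p G" using x y by (simp add: omega_center_def)
qed

text \<open>Refines the upper central series so that all factors have exponent \<open>p\<close>.\<close>

primrec upper_pseries :: "nat \<Rightarrow> ('a, 'b) monoid_scheme \<Rightarrow> nat \<Rightarrow> 'a set" where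
  "upper_pseries p G 0 = {\<one>\<^bsub>G\<^esub>}"
| "upper_pseries p G (Suc j) = {x \<in> carrier G.
     upper_pseries p G j #>\<^bsub>G\<^esub> x \<in> omega_center p (G Mod upper_pseries p G j)}"

declare upper_pseries.simps(2) [simp del]

context group
begin

text \<open>\<open>S\<close> is the preimage of \<open>Omega_1(Z(G / H))\<close>. Stating one step
  for an arbitrary normal subgroup lets normality of the whole series follow by induction.\<close>

lemma upper_pseries_step:
  fixes p :: nat
  assumes "H \<lhd> G"
  defines "S \<equiv> {x \<in> carrier G. H #> x \<in> omega_center p (G Mod H)}"
  shows "H \<subseteq> S" "S \<lhd> G" "\<And>x. x \<in> S \<Longrightarrow> x [^] p \<in> H"
    "\<And>g x. g \<in> carrier G \<Longrightarrow> x \<in> S \<Longrightarrow> commutator G g x \<in> H"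
proof -
  interpret H: normal H G by fact
  interpret q: group_hom G "G Mod H" "\<lambda>x. H #> x" by (rule H.group_hom_rcos)
  interpret c: subgroup "omega_center p (G Mod H)" "G Mod H" by (rule q.H.omega_center_subgroup)
  show H_S: "H \<subseteq> S"
  proof
    fix x assume "x \<in> H"
    then show "x \<in> S" using H.rcos_eq_one_iff[of x] c.one_closed by (simp add: S_def)
  qed
  have sub: "subgroup S G"
  proof (rule subgroupI)
    show "S \<noteq> {}" using H_S H.one_closed by blast
    show "inv x \<in> S" if "x \<in> S" for x
      using that c.m_inv_closed[of "H #> x"] by (simp add: S_def q.hom_inv)
    show "x \<otimes> y \<in> S" if "x \<in> S" "y \<in> S" for x y
      using that c.m_closed[of "H #> x" "H #> y"]
      by (simp add: S_def q.hom_mult del: mult_FactGroup)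
  qed (auto simp: S_def)
  show comm: "commutator G g x \<in> H" if "g \<in> carrier G" "x \<in> S" for g x
  proof -
    have x: "x \<in> carrier G" using that by (simp add: S_def)
    have "commutator (G Mod H) (H #> g) (H #> x) = \<one>\<^bsub>G Mod H\<^esub>"
      unfolding q.H.commutator_eq_one_iff[OF q.hom_closed[OF that(1)] q.hom_closed[OF x]]
      using that q.hom_closed[OF that(1)] 
      by (intro omega_centerD(3)[of _ p]) (simp_all add: S_def)
    then have "H #> commutator G g x = H" using that x q.hom_commutator[of g x] by simp
    then show ?thesis using that x H.rcos_eq_one_iff by simp
  qed
  show "S \<lhd> G"
  proof (rule normal_invI[OF sub])
    fix x g assume x: "x \<in> S" and g: "g \<in> carrier G"
    then have "commutator G g x \<otimes> x \<in> S" using comm H_S subgroup.m_closed[OF sub] by blast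
    then show "g \<otimes> x \<otimes> inv g \<in> S"
      using x g conj_eq_commutator_mult[of g x] by (simp add: S_def)
  qed
  show "x [^] p \<in> H" if "x \<in> S" for x
  proof -
    have x: "x \<in> carrier G" and "H #> x \<in> omega_center p (G Mod H)"
      using that by (auto simp: S_def)
    then have "H #> (x [^] p) = H"
      using omega_centerD(2) q.hom_nat_pow[OF x] by fastforce
    then show ?thesis using x H.rcos_eq_one_iff by simp
  qed
qed

lemma upper_pseries_normal: "upper_pseries p G j \<lhd> G"
  by (induction j) (simp_all add: one_is_normal upper_pseries_step(2) upper_pseries.simps(2))

lemma upper_pseries_Suc_mono: "upper_pseries p G j \<subseteq> upper_pseries p G (Suc j)"
  unfolding upper_pseries.simps(2) by (rule upper_pseries_step[OF upper_pseries_normal])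

lemma upper_pseries_pow: "x \<in> upper_pseries p G (Suc j) \<Longrightarrow> x [^] p \<in> upper_pseries p G j"
  unfolding upper_pseries.simps(2) by (rule upper_pseries_step[OF upper_pseries_normal])

lemma upper_pseries_commutator:
  "g \<in> carrier G \<Longrightarrow> x \<in> upper_pseries p G (Suc j) \<Longrightarrow> commutator G g x \<in> upper_pseries p G j"
  unfolding upper_pseries.simps(2) by (rule upper_pseries_step[OF upper_pseries_normal])

text \<open>The quotient by a proper term is a nontrivial \<open>p\<close>-group and has a
  nontrivial central element of order \<open>p\<close>, so the next term is strictly larger.\<close>

lemma upper_pseries_exhausts:
  assumes "prime p" and "finite_p_group p G"
  obtains r where "upper_pseries p G r = carrier G"
proof -
  from assms(2) obtain n where fin: "finite (carrier G)" and ord: "order G = p ^ n"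
    by (auto simp: finite_p_group_def)
  have sub: "upper_pseries p G j \<subseteq> carrier G" for j
    using normal_imp_subgroup[OF upper_pseries_normal] subgroup.subset by blast
  \<comment> \<open>The strict bound holds at the start, since \<open>upper_pseries p G 0\<close>
    has one element; it is absurd once \<open>j\<close> reaches the order of
    \<open>G\<close>.\<close>
  have "upper_pseries p G j = carrier G \<or> j < card (upper_pseries p G j)" for j
  proof (induction j)
    case (Suc j)
    let ?Z = "upper_pseries p G j"
    show ?case
    proof (cases "?Z = carrier G")
      case True
      with upper_pseries_Suc_mono[of p j] sub[of "Suc j"] show ?thesis by simp
    next
      case False
      interpret Z: normal ?Z G by (rule upper_pseries_normal)
      interpret q: group_hom G "G Mod ?Z" "\<lambda>x. ?Z #> x" by (rule Z.group_hom_rcos)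
      have "order (G Mod ?Z) * card ?Z = p ^ n"
        using lagrange[OF Z.is_subgroup] ord by (simp add: order_def FactGroup_def)
      then have "order (G Mod ?Z) dvd p ^ n" by (metis dvd_triv_left)
      then obtain m where "order (G Mod ?Z) = p ^ m"
        using divides_primepow_nat[OF assms(1)] by auto
      moreover have "finite (carrier (G Mod ?Z))" using fin by (simp add: carrier_FactGroup)
      ultimately have pg: "finite_p_group p (G Mod ?Z)"
        using q.H.is_group by (auto simp: finite_p_group_def)
      from False sub obtain y where "y \<in> carrier G" "y \<notin> ?Z" by blast
      then have "carrier (G Mod ?Z) \<noteq> {\<one>\<^bsub>G Mod ?Z\<^esub>}"
        using Z.rcos_eq_one_iff by (auto simp: carrier_FactGroup)
      then obtain K where K: "K \<in> omega_center p (G Mod ?Z)" "K \<noteq> \<one>\<^bsub>G Mod ?Z\<^esub>"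
      proof (rule q.H.finite_p_group_central_element[OF assms(1) pg])
        fix K assume "K \<in> carrier (G Mod ?Z)" "K [^]\<^bsub>G Mod ?Z\<^esub> p = \<one>\<^bsub>G Mod ?Z\<^esub>"
          "\<And>g. g \<in> carrier (G Mod ?Z) \<Longrightarrow> g \<otimes>\<^bsub>G Mod ?Z\<^esub> K = K \<otimes>\<^bsub>G Mod ?Z\<^esub> g"
        then have "K \<in> omega_center p (G Mod ?Z)" unfolding omega_center_def by blast
        moreover assume "K \<noteq> \<one>\<^bsub>G Mod ?Z\<^esub>"
        ultimately show thesis by (rule that)
      qed
      then obtain x where x: "x \<in> carrier G" "K = ?Z #> x"
        by (auto simp: omega_center_def carrier_FactGroup)
      have "x \<in> upper_pseries p G (Suc j)" using K x by (simp add: upper_pseries.simps(2))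
      moreover have "x \<notin> ?Z" using K x Z.rcos_eq_one_iff by auto
      ultimately have "?Z \<subset> upper_pseries p G (Suc j)" using upper_pseries_Suc_mono by blast
      then have "card ?Z < card (upper_pseries p G (Suc j))"
        using sub fin by (meson finite_subset psubset_card_mono)
      then show ?thesis using Suc False by linarith
    qed
  qed simp
  moreover have "card (upper_pseries p G j) \<le> card (carrier G)" for j
    using sub fin by (rule card_mono[rotated])
  ultimately have "upper_pseries p G (card (carrier G)) = carrier G" by (meson not_less)
  then show thesis by (rule that)
qed

end

section \<open>Cocycles with values in the nonzero complex numbers\<close>

lemma complex_units_group: "comm_group complex_units"
proof (rule comm_groupI)
  fix x assume "x \<in> carrier complex_units"
  then show "\<exists>y \<in> carrier complex_units. y \<otimes>\<^bsub>complex_units\<^esub> x = \<one>\<^bsub>complex_units\<^esub>"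
    by (intro bexI[of _ "inverse x"]) (auto simp: complex_units_def)
qed (auto simp: complex_units_def)

lemma complex_units_simps [simp]:
  "carrier complex_units = - {0}" "x \<otimes>\<^bsub>complex_units\<^esub> y = x * y" "\<one>\<^bsub>complex_units\<^esub> = 1"
  by (simp_all add: complex_units_def)

lemma inv_complex_units [simp]: "x \<noteq> 0 \<Longrightarrow> inv\<^bsub>complex_units\<^esub> x = inverse x"
  using complex_units_group
  by (intro group.inv_equality) (auto simp: comm_group_def)

text \<open>Coboundaries in curried form, without division and without extensionality. The function
  \<open>u\<close> is the cochain whose coboundary is \<open>f\<close> on the carrier.\<close>

definition unit_coboundary :: "('a, 'b) monoid_scheme \<Rightarrow> ('a \<Rightarrow> 'a \<Rightarrow> complex) \<Rightarrow> bool" where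
  "unit_coboundary G f \<longleftrightarrow> (\<exists>u. (\<forall>g \<in> carrier G. u g \<noteq> 0) \<and>
     (\<forall>g \<in> carrier G. \<forall>h \<in> carrier G. f g h * u (g \<otimes>\<^bsub>G\<^esub> h) = u g * u h))"

locale unit_cocycle = group +
  fixes f :: "'a \<Rightarrow> 'a \<Rightarrow> complex"
  assumes nonzero: "g \<in> carrier G \<Longrightarrow> h \<in> carrier G \<Longrightarrow> f g h \<noteq> 0"
    and cocycle: "g \<in> carrier G \<Longrightarrow> h \<in> carrier G \<Longrightarrow> k \<in> carrier G \<Longrightarrow>
      f g h * f (g \<otimes> h) k = f h k * f g (h \<otimes> k)"

abbreviation cocycle_group ::
    "('a, 'b) monoid_scheme \<Rightarrow> ('a \<times> 'a \<Rightarrow> complex) monoid" where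
  "cocycle_group G \<equiv> (cochains2 G complex_units)\<lparr>carrier := cocycles2 G complex_units\<rparr>"

context group
begin

lemma in_cocycles2_iff:
  "F \<in> cocycles2 G complex_units \<longleftrightarrow>
     F \<in> extensional (carrier G \<times> carrier G) \<and> unit_cocycle G (curry F)"
  by (auto simp: cocycles2_def cochains2_def unit_cocycle_def unit_cocycle_axioms_def
      PiE_iff is_group)

text \<open>With \<open>in_cocycles2_iff\<close> this translates between extensional cochains on
  pairs and plain curried functions, where field arithmetic applies directly.\<close>

lemma in_coboundaries2_iff:
  "F \<in> coboundaries2 G complex_units \<longleftrightarrow>
     F \<in> extensional (carrier G \<times> carrier G) \<and> unit_coboundary G (curry F)"
proof
  assume "F \<in> coboundaries2 G complex_units"
  then obtain u where "u \<in> carrier G \<rightarrow> - {0}" and F: "F = coboundary2 G complex_units u"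
    by (auto simp: coboundaries2_def)
  then have u: "u g \<noteq> 0" if "g \<in> carrier G" for g using that by auto
  have "curry F g h * u (g \<otimes> h) = u g * u h" if "g \<in> carrier G" "h \<in> carrier G" for g h
    using that u[of "g \<otimes> h"] by (simp add: F coboundary2_def)
  with u have "unit_coboundary G (curry F)" by (auto simp: unit_coboundary_def)
  then show "F \<in> extensional (carrier G \<times> carrier G) \<and> unit_coboundary G (curry F)"
    by (simp add: F coboundary2_def)
next
  assume F: "F \<in> extensional (carrier G \<times> carrier G) \<and> unit_coboundary G (curry F)"
  then obtain u where u: "\<And>g. g \<in> carrier G \<Longrightarrow> u g \<noteq> 0"
    and eq: "\<And>g h. g \<in> carrier G \<Longrightarrow> h \<in> carrier G \<Longrightarrow> F (g, h) * u (g \<otimes> h) = u g * u h"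
    by (auto simp: unit_coboundary_def)
  have "F = coboundary2 G complex_units u"
  proof (rule extensionalityI[where A = "carrier G \<times> carrier G"])
    fix x assume "x \<in> carrier G \<times> carrier G"
    then obtain g h where x: "x = (g, h)" "g \<in> carrier G" "h \<in> carrier G" by auto
    then show "F x = coboundary2 G complex_units u x"
      using eq[of g h] u[of "g \<otimes> h"] by (simp add: coboundary2_def divide_simps)
  qed (use F in \<open>auto simp: coboundary2_def\<close>)
  with u show "F \<in> coboundaries2 G complex_units" by (auto simp: coboundaries2_def)
qed

section \<open>The second cohomology group as a quotient of abelian groups\<close>

lemma cochains2_group: "comm_group (cochains2 G complex_units)"
proof -
  have "group (cochains2 G complex_units)"
    unfolding cochains2_def using complex_units_group
    by (intro product_group) (auto simp: comm_group_def)
  then show ?thesis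
    by (rule group.group_comm_groupI) (auto simp: cochains2_def mult.commute)
qed

lemma cocycles2_subgroup: "subgroup (cocycles2 G complex_units) (cochains2 G complex_units)"
proof -
  interpret C: comm_group "cochains2 G complex_units" by (rule cochains2_group)
  have sub: "cocycles2 G complex_units \<subseteq> carrier (cochains2 G complex_units)"
    by (auto simp: cocycles2_def)
  show ?thesis
  proof (rule C.subgroupI[OF sub])
    have "\<one>\<^bsub>cochains2 G complex_units\<^esub> \<in> cocycles2 G complex_units"
      by (auto simp: cocycles2_def cochains2_def PiE_iff)
    then show "cocycles2 G complex_units \<noteq> {}" by blast
  next
    fix F assume F: "F \<in> cocycles2 G complex_units"
    then have nz: "F (g, h) \<noteq> 0" if "g \<in> carrier G" "h \<in> carrier G" for g h
      using that by (auto simp: cocycles2_def cochains2_def PiE_iff)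
    have eq: "F (g, h) * F (g \<otimes> h, k) = F (h, k) * F (g, h \<otimes> k)"
      if "g \<in> carrier G" "h \<in> carrier G" "k \<in> carrier G" for g h k
      using F that by (auto simp: cocycles2_def)
    have "F \<in> carrier (cochains2 G complex_units)" using F sub by auto
    then have "inv\<^bsub>cochains2 G complex_units\<^esub> F =
        (\<lambda>i \<in> carrier G \<times> carrier G. inv\<^bsub>complex_units\<^esub> (F i))"
      unfolding cochains2_def using complex_units_group
      by (intro inv_product_group) (auto simp: comm_group_def)
    also have "\<dots> = (\<lambda>i \<in> carrier G \<times> carrier G. inverse (F i))"
      using nz by (intro restrict_ext) auto
    finally have inv: "inv\<^bsub>cochains2 G complex_units\<^esub> F =
        (\<lambda>i \<in> carrier G \<times> carrier G. inverse (F i))" .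
    have "inverse (F (g, h)) * inverse (F (g \<otimes> h, k)) =
        inverse (F (h, k)) * inverse (F (g, h \<otimes> k))"
      if "g \<in> carrier G" "h \<in> carrier G" "k \<in> carrier G" for g h k
      using eq[OF that] by (metis inverse_mult_distrib)
    then show "inv\<^bsub>cochains2 G complex_units\<^esub> F \<in> cocycles2 G complex_units"
      unfolding inv using nz by (auto simp: cocycles2_def cochains2_def PiE_iff)
  next
    fix F E assume F: "F \<in> cocycles2 G complex_units" and E: "E \<in> cocycles2 G complex_units"
    have "F (g, h) * E (g, h) * (F (g \<otimes> h, k) * E (g \<otimes> h, k)) =
        F (h, k) * E (h, k) * (F (g, h \<otimes> k) * E (g, h \<otimes> k))"
      if "g \<in> carrier G" "h \<in> carrier G" "k \<in> carrier G" for g h k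
    proof -
      have "(F (g, h) * F (g \<otimes> h, k)) * (E (g, h) * E (g \<otimes> h, k)) =
          (F (h, k) * F (g, h \<otimes> k)) * (E (h, k) * E (g, h \<otimes> k))"
        using F E that by (auto simp: cocycles2_def)
      then show ?thesis by (simp only: mult.assoc mult.left_commute)
    qed
    then show "F \<otimes>\<^bsub>cochains2 G complex_units\<^esub> E \<in> cocycles2 G complex_units"
      using F E by (auto simp: cocycles2_def cochains2_def PiE_iff)
  qed
qed

lemma cocycle_group_comm_group: "comm_group (cocycle_group G)"
proof -
  interpret C: comm_group "cochains2 G complex_units" by (rule cochains2_group)
  interpret Z: group "cocycle_group G" by (rule C.subgroup_imp_group[OF cocycles2_subgroup])
  show ?thesis
    by (rule Z.group_comm_groupI) (auto simp: cochains2_def mult.commute)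
qed

text \<open>Both sides of the cocycle identity equal
  \<open>u g * u h * u k / u (g h k)\<close>.\<close>

lemma unit_coboundary_cocycle:
  assumes "unit_coboundary G f"
  shows "unit_cocycle G f"
proof -
  from assms obtain u where u: "\<And>g. g \<in> carrier G \<Longrightarrow> u g \<noteq> 0"
    and eq: "\<And>g h. g \<in> carrier G \<Longrightarrow> h \<in> carrier G \<Longrightarrow> f g h * u (g \<otimes> h) = u g * u h"
    unfolding unit_coboundary_def by blast
  have f: "f g h = u g * u h / u (g \<otimes> h)" if "g \<in> carrier G" "h \<in> carrier G" for g h
    using eq[OF that] u that by (simp add: divide_simps)
  show ?thesis
    by unfold_locales (simp_all add: f u m_assoc)
qed

lemma coboundaries2_normal: "coboundaries2 G complex_units \<lhd> cocycle_group G"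
proof -
  interpret C: comm_group "cocycle_group G" by (rule cocycle_group_comm_group)
  have mult: "F \<otimes>\<^bsub>cocycle_group G\<^esub> E = (\<lambda>i \<in> carrier G \<times> carrier G. F i * E i)" for F E
    by (simp add: cochains2_def)
  have sub: "coboundaries2 G complex_units \<subseteq> carrier (cocycle_group G)"
    using unit_coboundary_cocycle by (auto simp: in_coboundaries2_iff in_cocycles2_iff)
  have one: "\<one>\<^bsub>cocycle_group G\<^esub> \<in> coboundaries2 G complex_units"
    by (auto simp: cochains2_def in_coboundaries2_iff unit_coboundary_def intro!: exI[of _ "\<lambda>_. 1"])
  have "subgroup (coboundaries2 G complex_units) (cocycle_group G)"
  proof (rule C.subgroupI[OF sub])
    show "coboundaries2 G complex_units \<noteq> {}" using one by blast
  next
    fix F assume F: "F \<in> coboundaries2 G complex_units"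
    then obtain u where u: "\<And>g. g \<in> carrier G \<Longrightarrow> u g \<noteq> 0"
      and eq: "\<And>g h. g \<in> carrier G \<Longrightarrow> h \<in> carrier G \<Longrightarrow> F (g, h) * u (g \<otimes> h) = u g * u h"
      by (auto simp: in_coboundaries2_iff unit_coboundary_def)
    have nz: "F (g, h) \<noteq> 0" if "g \<in> carrier G" "h \<in> carrier G" for g h
      using eq[OF that] u that by auto
    define E where "E = (\<lambda>i \<in> carrier G \<times> carrier G. inverse (F i))"
    have "E (g, h) * inverse (u (g \<otimes> h)) = inverse (u g) * inverse (u h)"
      if "g \<in> carrier G" "h \<in> carrier G" for g h
      using eq[OF that] that by (simp add: E_def flip: inverse_mult_distrib)
    with u have E: "E \<in> coboundaries2 G complex_units"
      by (auto simp: in_coboundaries2_iff unit_coboundary_def E_def intro!: exI[of _ "\<lambda>g. inverse (u g)"])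
    have "E \<otimes>\<^bsub>cocycle_group G\<^esub> F = \<one>\<^bsub>cocycle_group G\<^esub>"
      unfolding mult using nz by (auto simp: cochains2_def E_def intro!: restrict_ext)
    then have "inv\<^bsub>cocycle_group G\<^esub> F = E"
      using E F sub by (intro C.inv_equality) auto
    with E show "inv\<^bsub>cocycle_group G\<^esub> F \<in> coboundaries2 G complex_units" by simp
  next
    fix F E assume F: "F \<in> coboundaries2 G complex_units" and E: "E \<in> coboundaries2 G complex_units"
    from F obtain u where u: "\<And>g. g \<in> carrier G \<Longrightarrow> u g \<noteq> 0"
      and eq: "\<And>g h. g \<in> carrier G \<Longrightarrow> h \<in> carrier G \<Longrightarrow> F (g, h) * u (g \<otimes> h) = u g * u h"
      by (auto simp: in_coboundaries2_iff unit_coboundary_def)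
    from E obtain v where v: "\<And>g. g \<in> carrier G \<Longrightarrow> v g \<noteq> 0"
      and eq': "\<And>g h. g \<in> carrier G \<Longrightarrow> h \<in> carrier G \<Longrightarrow> E (g, h) * v (g \<otimes> h) = v g * v h"
      by (auto simp: in_coboundaries2_iff unit_coboundary_def)
    have "F (g, h) * E (g, h) * (u (g \<otimes> h) * v (g \<otimes> h)) = (u g * v g) * (u h * v h)"
      if "g \<in> carrier G" "h \<in> carrier G" for g h
      using arg_cong2[OF eq[OF that] eq'[OF that], of "(*)"] by (simp only: mult_ac)
    with u v show "F \<otimes>\<^bsub>cocycle_group G\<^esub> E \<in> coboundaries2 G complex_units"
      unfolding mult
      by (auto simp: in_coboundaries2_iff unit_coboundary_def intro!: exI[of _ "\<lambda>g. u g * v g"])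
  qed
  then show ?thesis using C.normal_iff_subgroup by blast
qed

lemma schur_multiplier_group: "group (schur_multiplier G)"
  unfolding schur_multiplier_def cohomology2_def
  using normal.factorgroup_is_group[OF coboundaries2_normal] .

lemma cocycle_group_pow:
  "F \<in> cocycles2 G complex_units \<Longrightarrow>
    F [^]\<^bsub>cocycle_group G\<^esub> (n::nat) = (\<lambda>i \<in> carrier G \<times> carrier G. F i ^ n)"
proof (induction n)
  case 0
  then show ?case by (simp add: nat_pow_def cochains2_def)
next
  case (Suc n)
  then show ?case
    by (auto simp: nat_pow_def cochains2_def mult.commute intro!: restrict_ext)
qed

text \<open>A power of a class is the class of the pointwise power, so exponents of the multiplier
  become statements about powers of cocycles.\<close>

lemma schur_multiplier_pow_eq_one_iff:
  assumes F: "F \<in> cocycles2 G complex_units"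
  defines "c \<equiv> coboundaries2 G complex_units #>\<^bsub>cocycle_group G\<^esub> F"
  shows "c \<in> carrier (schur_multiplier G)"
    and "c [^]\<^bsub>schur_multiplier G\<^esub> (n::nat) = \<one>\<^bsub>schur_multiplier G\<^esub> \<longleftrightarrow>
      unit_coboundary G (\<lambda>g h. F (g, h) ^ n)"
proof -
  interpret B: normal "coboundaries2 G complex_units" "cocycle_group G"
    by (rule coboundaries2_normal)
  have F': "F \<in> carrier (cocycle_group G)" using F by simp
  show "c \<in> carrier (schur_multiplier G)"
    unfolding schur_multiplier_def cohomology2_def c_def using F by (auto simp: carrier_FactGroup)
  have "c [^]\<^bsub>schur_multiplier G\<^esub> n = coboundaries2 G complex_units #>\<^bsub>cocycle_group G\<^esub>
      (F [^]\<^bsub>cocycle_group G\<^esub> n)"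
    unfolding schur_multiplier_def cohomology2_def c_def by (rule B.FactGroup_pow[OF F'])
  then have "c [^]\<^bsub>schur_multiplier G\<^esub> n = \<one>\<^bsub>schur_multiplier G\<^esub> \<longleftrightarrow>
      F [^]\<^bsub>cocycle_group G\<^esub> n \<in> coboundaries2 G complex_units"
    using B.rcos_eq_one_iff[OF B.nat_pow_closed[OF F']]
    by (simp add: schur_multiplier_def cohomology2_def)
  also have "\<dots> \<longleftrightarrow> unit_coboundary G (\<lambda>g h. F (g, h) ^ n)"
    unfolding cocycle_group_pow[OF F] in_coboundaries2_iff by (simp add: unit_coboundary_def)
  finally show "c [^]\<^bsub>schur_multiplier G\<^esub> n = \<one>\<^bsub>schur_multiplier G\<^esub> \<longleftrightarrow>
      unit_coboundary G (\<lambda>g h. F (g, h) ^ n)" .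
qed

lemma carrier_schur_multiplierE:
  assumes "c \<in> carrier (schur_multiplier G)"
  obtains F where "F \<in> cocycles2 G complex_units"
    "c = coboundaries2 G complex_units #>\<^bsub>cocycle_group G\<^esub> F"
  using assms by (auto simp: schur_multiplier_def cohomology2_def carrier_FactGroup)

section \<open>Exponents of groups and of the Schur multiplier\<close>

lemma group_exponent_dvd:
  assumes "n > 0" "\<And>g. g \<in> carrier G \<Longrightarrow> g [^] (n::nat) = \<one>"
  shows "group_exponent G dvd n"
proof -
  let ?P = "\<lambda>n. n > 0 \<and> (\<forall>g \<in> carrier G. g [^] (n::nat) = \<one>)"
  have exp: "group_exponent G = (LEAST n. ?P n)"
    unfolding group_exponent_def using assms by (intro if_P) blast
  have least: "?P (group_exponent G)"
    unfolding exp by (rule LeastI[of ?P n]) (use assms in auto)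
  show ?thesis
  proof (rule ccontr)
    assume "\<not> group_exponent G dvd n"
    then have "0 < n mod group_exponent G" by (simp add: dvd_eq_mod_eq_0)
    \<comment> \<open>The order of \<open>g\<close> divides both \<open>n\<close> and the exponent,
      hence the remainder; minimality of the exponent then excludes a positive remainder.\<close>
    moreover have "g [^] (n mod group_exponent G) = \<one>" if g: "g \<in> carrier G" for g
    proof -
      have "ord g dvd n mod group_exponent G"
        using g assms least by (simp add: dvd_mod pow_eq_id)
      then show ?thesis using g by (simp add: pow_eq_id)
    qed
    ultimately have "group_exponent G \<le> n mod group_exponent G"
      unfolding exp[symmetric] by (subst exp) (intro Least_le, auto)
    then show False using least by (meson mod_less_divisor not_less)
  qed
qed

lemma pow_group_exponent:
  assumes "g \<in> carrier G"
  shows "g [^] group_exponent G = \<one>"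
proof (cases "\<exists>n>0. \<forall>g \<in> carrier G. g [^] (n::nat) = \<one>")
  case True
  then have "\<forall>g \<in> carrier G. g [^] group_exponent G = \<one>"
    unfolding group_exponent_def
    by (simp only: if_True) (rule LeastI2_ex[where Q = "\<lambda>n. \<forall>g \<in> carrier G. g [^] n = \<one>"], auto)
  with assms show ?thesis by blast
next
  \<comment> \<open>With no positive exponent the default value 0 applies, and \<open>g ^ 0\<close>
    is the identity.\<close>
  case False
  then have "group_exponent G = 0" unfolding group_exponent_def by (rule if_not_P)
  then show ?thesis by simp
qed

lemma group_exponent_schur_multiplier_dvd:
  assumes "n > 0" and "\<And>f. unit_cocycle G f \<Longrightarrow> unit_coboundary G (\<lambda>g h. f g h ^ n)"
  shows "group_exponent (schur_multiplier G) dvd n"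
proof (rule group.group_exponent_dvd[OF schur_multiplier_group assms(1)])
  fix c assume "c \<in> carrier (schur_multiplier G)"
  then obtain F where F: "F \<in> cocycles2 G complex_units"
    and c: "c = coboundaries2 G complex_units #>\<^bsub>cocycle_group G\<^esub> F"
    by (rule carrier_schur_multiplierE)
  have "unit_coboundary G (\<lambda>g h. F (g, h) ^ n)"
    using assms(2)[of "curry F"] F by (simp add: in_cocycles2_iff)
  then show "c [^]\<^bsub>schur_multiplier G\<^esub> n = \<one>\<^bsub>schur_multiplier G\<^esub>"
    unfolding c by (simp only: schur_multiplier_pow_eq_one_iff(2)[OF F])
qed

lemma unit_coboundary_cong:
  assumes "\<And>g h. g \<in> carrier G \<Longrightarrow> h \<in> carrier G \<Longrightarrow> f g h = f' g h"
  shows "unit_coboundary G f \<longleftrightarrow> unit_coboundary G f'"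
  using assms by (simp add: unit_coboundary_def)

text \<open>The converse direction: a bound on the exponent yields cochains. Restricting
  \<open>f\<close> to pairs from the carrier turns it into an extensional cochain representing a
  class.\<close>

lemma unit_coboundary_pow:
  assumes f: "unit_cocycle G f" and dvd: "group_exponent (schur_multiplier G) dvd n"
  shows "unit_coboundary G (\<lambda>g h. f g h ^ n)"
proof -
  let ?F = "\<lambda>(g, h) \<in> carrier G \<times> carrier G. f g h"
  interpret M: group "schur_multiplier G" by (rule schur_multiplier_group)
  have "unit_cocycle G (curry ?F)"
    using f by (simp add: unit_cocycle_def unit_cocycle_axioms_def)
  then have F: "?F \<in> cocycles2 G complex_units" by (simp add: in_cocycles2_iff)
  let ?c = "coboundaries2 G complex_units #>\<^bsub>cocycle_group G\<^esub> ?F"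
  have "group.ord (schur_multiplier G) ?c dvd n"
    using dvd M.pow_group_exponent[OF schur_multiplier_pow_eq_one_iff(1)[OF F]]
      M.pow_eq_id[OF schur_multiplier_pow_eq_one_iff(1)[OF F]] dvd_trans by blast
  then have "unit_coboundary G (\<lambda>g h. ?F (g, h) ^ n)"
    using schur_multiplier_pow_eq_one_iff[OF F] M.pow_eq_id by blast
  then show ?thesis by (subst (asm) unit_coboundary_cong) auto
qed

lemma unit_coboundary_of_trivial:
  assumes "unit_cocycle G f" and "trivial_group (schur_multiplier G)"
  shows "unit_coboundary G f"
proof -
  interpret M: group "schur_multiplier G" by (rule schur_multiplier_group)
  have "group_exponent (schur_multiplier G) dvd 1"
    using assms(2) by (intro M.group_exponent_dvd) (auto simp: trivial_group_def)
  from unit_coboundary_pow[OF assms(1) this] show ?thesis by simp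
qed

end

section \<open>The central extension defined by a cocycle\<close>

text \<open>The cocycle is not assumed to be normalised, which is why the identity carries the
  factor \<open>inverse (f 1 1)\<close>.\<close>

definition cocycle_ext :: "('a, 'b) monoid_scheme \<Rightarrow> ('a \<Rightarrow> 'a \<Rightarrow> complex) \<Rightarrow> (complex \<times> 'a) monoid" where
  "cocycle_ext G f = \<lparr>carrier = (- {0}) \<times> carrier G,
     monoid.mult = (\<lambda>(a, g) (b, h). (a * b * f g h, g \<otimes>\<^bsub>G\<^esub> h)),
     one = (inverse (f \<one>\<^bsub>G\<^esub> \<one>\<^bsub>G\<^esub>), \<one>\<^bsub>G\<^esub>)\<rparr>"

lemma cocycle_ext_simps:
  "carrier (cocycle_ext G f) = (- {0}) \<times> carrier G"
  "x \<otimes>\<^bsub>cocycle_ext G f\<^esub> y = (fst x * fst y * f (snd x) (snd y), snd x \<otimes>\<^bsub>G\<^esub> snd y)"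
  "\<one>\<^bsub>cocycle_ext G f\<^esub> = (inverse (f \<one>\<^bsub>G\<^esub> \<one>\<^bsub>G\<^esub>), \<one>\<^bsub>G\<^esub>)"
  by (simp_all add: cocycle_ext_def case_prod_beta)

text \<open>Identifies the extension of \<open>N\<close> by the restricted cocycle with the preimage
  \<open>M\<close> inside the extension of \<open>G\<close>.\<close>

lemma cocycle_ext_restrict:
  "cocycle_ext (G\<lparr>carrier := N\<rparr>) f = (cocycle_ext G f)\<lparr>carrier := (- {0}) \<times> N\<rparr>"
  by (simp add: cocycle_ext_def)

context unit_cocycle
begin

abbreviation E where "E \<equiv> cocycle_ext G f"

text \<open>Dividing by \<open>f 1 1\<close> makes this map multiplicative; multiplication by
  \<open>scalar z\<close> then just multiplies the first component by \<open>z\<close>.\<close>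

definition scalar :: "complex \<Rightarrow> complex \<times> 'a" where
  "scalar z = (z / f \<one> \<one>, \<one>)"

lemma f_one_left: "g \<in> carrier G \<Longrightarrow> f \<one> g = f \<one> \<one>"
  using cocycle[of \<one> \<one> g] nonzero[of \<one> g] by simp

lemma f_one_right: "g \<in> carrier G \<Longrightarrow> f g \<one> = f \<one> \<one>"
  using cocycle[of g \<one> \<one>] nonzero[of g \<one>] by simp

lemma E_group: "group E"
proof (rule groupI)
  fix x y z assume "x \<in> carrier E" "y \<in> carrier E" "z \<in> carrier E"
  then show "x \<otimes>\<^bsub>E\<^esub> y \<otimes>\<^bsub>E\<^esub> z = x \<otimes>\<^bsub>E\<^esub> (y \<otimes>\<^bsub>E\<^esub> z)"
    using cocycle[of "snd x" "snd y" "snd z"]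
    by (auto simp: cocycle_ext_simps m_assoc)
next
  fix x assume x: "x \<in> carrier E"
  then show "\<one>\<^bsub>E\<^esub> \<otimes>\<^bsub>E\<^esub> x = x" using f_one_left[of "snd x"] nonzero[of \<one> \<one>]
    by (auto simp: cocycle_ext_simps)
  show "\<exists>y \<in> carrier E. y \<otimes>\<^bsub>E\<^esub> x = \<one>\<^bsub>E\<^esub>"
    using x nonzero
    by (intro bexI[of _ "(inverse (fst x * f (inv (snd x)) (snd x) * f \<one> \<one>), inv (snd x))"])
      (auto simp: cocycle_ext_simps divide_simps)
qed (auto simp: cocycle_ext_simps nonzero)

lemma snd_hom: "group_hom E G snd"
  unfolding group_hom_def group_hom_axioms_def hom_def
  using E_group is_group by (auto simp: cocycle_ext_simps)

lemma scalar_closed: "z \<noteq> 0 \<Longrightarrow> scalar z \<in> carrier E"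
  by (simp add: scalar_def cocycle_ext_simps nonzero)

lemma scalar_mult: "x \<in> carrier E \<Longrightarrow> scalar z \<otimes>\<^bsub>E\<^esub> x = (z * fst x, snd x)"
  using f_one_left[of "snd x"] nonzero[of \<one> \<one>] by (auto simp: scalar_def cocycle_ext_simps)

lemma mult_scalar: "x \<in> carrier E \<Longrightarrow> x \<otimes>\<^bsub>E\<^esub> scalar z = (z * fst x, snd x)"
  using f_one_right[of "snd x"] nonzero[of \<one> \<one>] by (auto simp: scalar_def cocycle_ext_simps)

lemma scalar_commute: "x \<in> carrier E \<Longrightarrow> scalar z \<otimes>\<^bsub>E\<^esub> x = x \<otimes>\<^bsub>E\<^esub> scalar z"
  by (simp add: scalar_mult mult_scalar)

lemma scalar_mult_scalar: "z \<noteq> 0 \<Longrightarrow> w \<noteq> 0 \<Longrightarrow> scalar z \<otimes>\<^bsub>E\<^esub> scalar w = scalar (z * w)"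
  using scalar_mult[OF scalar_closed, of w z] by (simp add: scalar_def)

lemma scalar_one: "scalar 1 = \<one>\<^bsub>E\<^esub>"
  by (simp add: scalar_def cocycle_ext_simps inverse_eq_divide)

lemma scalar_pow: "z \<noteq> 0 \<Longrightarrow> scalar z [^]\<^bsub>E\<^esub> (n::nat) = scalar (z ^ n)"
  by (induction n) (simp_all add: scalar_one scalar_mult_scalar mult.commute)

lemma scalar_inj: "scalar z = scalar w \<Longrightarrow> z = w"
  using nonzero[of \<one> \<one>] by (simp add: scalar_def)

lemma scalarE:
  assumes "x \<in> carrier E" "snd x = \<one>"
  obtains z where "z \<noteq> 0" "x = scalar z"
  using assms nonzero[of \<one> \<one>]
  by (intro that[of "fst x * f \<one> \<one>"]) (auto simp: scalar_def cocycle_ext_simps)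

lemma kernel_commute:
  assumes "x \<in> carrier E" "snd x = \<one>" "y \<in> carrier E"
  shows "x \<otimes>\<^bsub>E\<^esub> y = y \<otimes>\<^bsub>E\<^esub> x"
  using assms by (metis scalarE scalar_commute)

text \<open>The images \<open>g\<close>, \<open>h\<close> of \<open>x\<close>, \<open>y\<close>
  generate the required subgroup, through the map taking \<open>(i, j)\<close> to
  \<open>g ^ i h ^ j\<close>. It is injective because a kernel element lifts to a central element,
  and commuting it with \<open>x\<close> and \<open>y\<close> forces powers of the commutator to
  vanish.\<close>

lemma order_n_commutator_homocyclic:
  assumes comm: "\<And>g h. g \<in> carrier G \<Longrightarrow> h \<in> carrier G \<Longrightarrow> g \<otimes> h = h \<otimes> g"
    and exp: "\<And>g. g \<in> carrier G \<Longrightarrow> g [^] n = \<one>" and n: "n > 0"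
    and x: "x \<in> carrier E" and y: "y \<in> carrier E"
    and ord: "group.ord E (commutator E y x) = n"
  shows "\<exists>A. subgroup A G \<and> G\<lparr>carrier := A\<rparr> \<cong> integer_mod_group n \<times>\<times> integer_mod_group n"
proof -
  interpret E: group E by (rule E_group)
  interpret s: group_hom E G snd by (rule snd_hom)
  interpret K: group "integer_mod_group n \<times>\<times> integer_mod_group n" by (simp add: DirProd_group)
  let ?K = "integer_mod_group n \<times>\<times> integer_mod_group n"
  let ?c = "commutator E y x"
  have c: "?c \<in> carrier E" using x y by simp
  define g h where "g = snd x" and "h = snd y"
  have g: "g \<in> carrier G" and h: "h \<in> carrier G" using x y by (simp_all add: g_def h_def s.hom_closed)
  have "snd ?c = \<one>"
    using x y comm[OF h g] g h by (simp add: s.hom_commutator commutator_eq_one_iff flip: g_def h_def)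
  then have c_comm: "?c \<otimes>\<^bsub>E\<^esub> z = z \<otimes>\<^bsub>E\<^esub> ?c" if "z \<in> carrier E" for z
    using kernel_commute[OF c] that by blast
  have yx: "y \<otimes>\<^bsub>E\<^esub> x = ?c \<otimes>\<^bsub>E\<^esub> (x \<otimes>\<^bsub>E\<^esub> y)" by (rule E.mult_eq_commutator_mult[OF y x])
  \<comment> \<open>Addition in \<open>integer_mod_group n\<close> reduces modulo \<open>n\<close>;
    this makes the reduction harmless for exponents.\<close>
  have pow_mod: "k [^] (m mod n) = k [^] m" if "k \<in> carrier G" for k and m :: nat
  proof -
    have "k [^] m = k [^] (n * (m div n) + m mod n)" by simp
    also have "\<dots> = (k [^] n) [^] (m div n) \<otimes> k [^] (m mod n)"
      using that by (simp only: nat_pow_mult nat_pow_pow nat_pow_closed)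
    finally show ?thesis using that exp by simp
  qed
  define \<phi> where "\<phi> = (\<lambda>(i, j). g [^] nat i \<otimes> h [^] nat j)"
  have hom: "\<phi> \<in> hom ?K G"
  proof (rule homI)
    show "\<phi> u \<in> carrier G" for u using g h by (auto simp: \<phi>_def split: prod.split)
    fix u v assume u: "u \<in> carrier ?K" and v: "v \<in> carrier ?K"
    obtain i j where ij: "u = (i, j)" by (cases u)
    obtain i' j' where ij': "v = (i', j')" by (cases v)
    have pos: "i \<ge> 0" "j \<ge> 0" "i' \<ge> 0" "j' \<ge> 0"
      using u v n by (auto simp: ij ij' carrier_integer_mod_group)
    have "\<phi> (u \<otimes>\<^bsub>?K\<^esub> v) = g [^] ((nat i + nat i') mod n) \<otimes> h [^] ((nat j + nat j') mod n)"
      using pos by (simp add: ij ij' \<phi>_def nat_mod_distrib nat_add_distrib)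
    also have "\<dots> = g [^] nat i \<otimes> (g [^] nat i' \<otimes> h [^] nat j) \<otimes> h [^] nat j'"
      using g h by (simp add: pow_mod m_assoc flip: nat_pow_mult)
    also have "g [^] nat i' \<otimes> h [^] nat j = h [^] nat j \<otimes> g [^] nat i'"
      using g h by (intro comm nat_pow_closed)
    finally show "\<phi> (u \<otimes>\<^bsub>?K\<^esub> v) = \<phi> u \<otimes> \<phi> v"
      using g h by (simp add: ij ij' \<phi>_def m_assoc)
  qed
  interpret \<phi>: group_hom ?K G \<phi> using hom by unfold_locales
  \<comment> \<open>\<open>x ^ i y ^ j\<close> lies over the identity and commutes with
    \<open>x\<close>, whereas moving \<open>x\<close> through it produces \<open>c ^ j\<close>;
    hence \<open>n\<close> divides \<open>j\<close>.\<close>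
  have ker: "i = 0 \<and> j = 0" if eq: "g [^] i \<otimes> h [^] j = \<one>" and lt: "i < n" "j < n" for i j :: nat
  proof -
    let ?z = "x [^]\<^bsub>E\<^esub> i \<otimes>\<^bsub>E\<^esub> y [^]\<^bsub>E\<^esub> j"
    have z: "?z \<in> carrier E" "snd ?z = \<one>"
      using x y eq by (simp_all only: E.m_closed E.nat_pow_closed s.hom_mult s.hom_nat_pow g_def h_def)
    have ci: "?c [^]\<^bsub>E\<^esub> m \<in> carrier E" for m :: nat using c by simp
    have "?z \<otimes>\<^bsub>E\<^esub> x = x [^]\<^bsub>E\<^esub> i \<otimes>\<^bsub>E\<^esub> (y [^]\<^bsub>E\<^esub> j \<otimes>\<^bsub>E\<^esub> x)"
      using x y by (simp add: E.m_assoc)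
    also have "\<dots> = x [^]\<^bsub>E\<^esub> i \<otimes>\<^bsub>E\<^esub> ?c [^]\<^bsub>E\<^esub> j \<otimes>\<^bsub>E\<^esub> (x \<otimes>\<^bsub>E\<^esub> y [^]\<^bsub>E\<^esub> j)"
      unfolding E.class_two_pow_commute[OF x y c c_comm[OF y] yx]
      using x y c by (simp add: E.m_assoc)
    also have "x [^]\<^bsub>E\<^esub> i \<otimes>\<^bsub>E\<^esub> ?c [^]\<^bsub>E\<^esub> j = ?c [^]\<^bsub>E\<^esub> j \<otimes>\<^bsub>E\<^esub> x [^]\<^bsub>E\<^esub> i"
      by (rule E.group_commutes_pow[OF c_comm, symmetric]) (use x c in auto)
    also have "?c [^]\<^bsub>E\<^esub> j \<otimes>\<^bsub>E\<^esub> x [^]\<^bsub>E\<^esub> i \<otimes>\<^bsub>E\<^esub> (x \<otimes>\<^bsub>E\<^esub> y [^]\<^bsub>E\<^esub> j) =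
        ?c [^]\<^bsub>E\<^esub> j \<otimes>\<^bsub>E\<^esub> (x [^]\<^bsub>E\<^esub> Suc i \<otimes>\<^bsub>E\<^esub> y [^]\<^bsub>E\<^esub> j)"
      using x y c by (simp add: E.m_assoc)
    also have "x [^]\<^bsub>E\<^esub> Suc i \<otimes>\<^bsub>E\<^esub> y [^]\<^bsub>E\<^esub> j = x \<otimes>\<^bsub>E\<^esub> ?z"
      unfolding E.nat_pow_Suc2[OF x] using x y by (simp add: E.m_assoc)
    also have "x \<otimes>\<^bsub>E\<^esub> ?z = ?z \<otimes>\<^bsub>E\<^esub> x" by (rule kernel_commute[OF z x, symmetric])
    finally have "?c [^]\<^bsub>E\<^esub> j = \<one>\<^bsub>E\<^esub>"
      using E.r_cancel_one'[OF E.m_closed[OF z(1) x] ci] by (simp only:)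
    then have "n dvd j" using E.pow_eq_id[OF c] ord by simp
    then have j: "j = 0" using lt dvd_imp_le[of n j] by (cases "j = 0") auto
    \<comment> \<open>With \<open>j = 0\<close>, \<open>x ^ i\<close> itself is central. Now
      \<open>y\<close> is moved through it; as the roles are exchanged, the commutator is the
      inverse of \<open>c\<close>.\<close>
    have xi: "x [^]\<^bsub>E\<^esub> i \<in> carrier E" "snd (x [^]\<^bsub>E\<^esub> i) = \<one>"
      using z x j by simp_all
    have xy: "x \<otimes>\<^bsub>E\<^esub> y = commutator E x y \<otimes>\<^bsub>E\<^esub> (y \<otimes>\<^bsub>E\<^esub> x)"
      by (rule E.mult_eq_commutator_mult[OF x y])
    have ic: "commutator E x y = inv\<^bsub>E\<^esub> ?c" using x y by (simp add: E.commutator_inv)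
    have "snd (commutator E x y) = \<one>" using \<open>snd ?c = \<one>\<close> c by (simp add: ic)
    then have "commutator E x y \<otimes>\<^bsub>E\<^esub> x = x \<otimes>\<^bsub>E\<^esub> commutator E x y"
      using x y by (intro kernel_commute) simp_all
    from E.class_two_pow_commute[OF y x _ this xy]
    have "x [^]\<^bsub>E\<^esub> i \<otimes>\<^bsub>E\<^esub> y = commutator E x y [^]\<^bsub>E\<^esub> i \<otimes>\<^bsub>E\<^esub> (y \<otimes>\<^bsub>E\<^esub> x [^]\<^bsub>E\<^esub> i)"
      using x y by simp
    also have "y \<otimes>\<^bsub>E\<^esub> x [^]\<^bsub>E\<^esub> i = x [^]\<^bsub>E\<^esub> i \<otimes>\<^bsub>E\<^esub> y" by (rule kernel_commute[OF xi y, symmetric])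
    finally have "commutator E x y [^]\<^bsub>E\<^esub> i = \<one>\<^bsub>E\<^esub>"
      using E.r_cancel_one'[OF E.m_closed[OF xi(1) y], of "commutator E x y [^]\<^bsub>E\<^esub> i"] x y by simp
    then have "?c [^]\<^bsub>E\<^esub> i = \<one>\<^bsub>E\<^esub>"
      using c by (simp add: ic E.nat_pow_inv)
    then have "n dvd i" using E.pow_eq_id[OF c] ord by simp
    then show ?thesis using lt j dvd_imp_le[of n i] by (cases "i = 0") auto
  qed
  have inj: "inj_on \<phi> (carrier ?K)"
  proof (rule \<phi>.trivial_ker_imp_inj)
    have "u = \<one>\<^bsub>?K\<^esub>" if "u \<in> carrier ?K" "\<phi> u = \<one>" for u
    proof -
      obtain i j where u: "u = (i, j)" by (cases u)
      have ij: "0 \<le> i" "i < int n" "0 \<le> j" "j < int n"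
        using that(1) n by (simp_all add: u carrier_integer_mod_group)
      have "g [^] nat i \<otimes> h [^] nat j = \<one>" using that(2) by (simp add: u \<phi>_def)
      then have "nat i = 0 \<and> nat j = 0" by (rule ker) (use ij in auto)
      with ij show ?thesis by (simp add: u)
    qed
    then show "kernel ?K G \<phi> = {\<one>\<^bsub>?K\<^esub>}"
      using \<phi>.hom_one by (auto simp: kernel_def simp del: \<phi>.hom_one)
  qed
  let ?A = "\<phi> ` carrier ?K"
  have "\<phi> \<in> iso ?K (G\<lparr>carrier := ?A\<rparr>)"
    using hom inj by (auto simp: iso_def hom_def bij_betw_def)
  then have "?K \<cong> G\<lparr>carrier := ?A\<rparr>" by (auto simp: is_iso_def)
  then have "G\<lparr>carrier := ?A\<rparr> \<cong> ?K" by (rule K.iso_sym)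
  moreover have "subgroup ?A G" by (rule \<phi>.img_is_subgroup)
  ultimately show ?thesis by blast
qed

text \<open>As \<open>y ^ n\<close> is central, \<open>c ^ n = 1\<close>, so \<open>c\<close> has
  order \<open>2 ^ j\<close> with \<open>j \<le> k\<close>. The excluded homocyclic subgroup rules
  out \<open>j = k\<close>, and then the order of \<open>c\<close> divides
  \<open>n choose 2\<close>.\<close>

lemma ext_pow_mult_abelian_two_group:
  assumes comm: "\<And>g h. g \<in> carrier G \<Longrightarrow> h \<in> carrier G \<Longrightarrow> g \<otimes> h = h \<otimes> g"
    and exp: "\<And>g. g \<in> carrier G \<Longrightarrow> g [^] ((2::nat) ^ k) = \<one>"
    and no: "\<nexists>A. subgroup A G \<and>
      G\<lparr>carrier := A\<rparr> \<cong> integer_mod_group (2 ^ k) \<times>\<times> integer_mod_group (2 ^ k)"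
    and x: "x \<in> carrier E" and y: "y \<in> carrier E"
  shows "(x \<otimes>\<^bsub>E\<^esub> y) [^]\<^bsub>E\<^esub> ((2::nat) ^ k) = x [^]\<^bsub>E\<^esub> ((2::nat) ^ k) \<otimes>\<^bsub>E\<^esub> y [^]\<^bsub>E\<^esub> ((2::nat) ^ k)"
proof -
  interpret E: group E by (rule E_group)
  interpret s: group_hom E G snd by (rule snd_hom)
  let ?n = "(2::nat) ^ k" and ?c = "commutator E y x"
  have c: "?c \<in> carrier E" using x y by simp
  have "snd ?c = \<one>"
    using x y comm[of "snd y" "snd x"] by (simp add: s.hom_commutator s.hom_closed commutator_eq_one_iff)
  then have c_comm: "?c \<otimes>\<^bsub>E\<^esub> z = z \<otimes>\<^bsub>E\<^esub> ?c" if "z \<in> carrier E" for z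
    using kernel_commute[OF c] that by blast
  have yx: "y \<otimes>\<^bsub>E\<^esub> x = ?c \<otimes>\<^bsub>E\<^esub> (x \<otimes>\<^bsub>E\<^esub> y)" by (rule E.mult_eq_commutator_mult[OF y x])
  have "snd (y [^]\<^bsub>E\<^esub> ?n) = \<one>" using y by (simp add: s.hom_nat_pow exp s.hom_closed)
  then have "y [^]\<^bsub>E\<^esub> ?n \<otimes>\<^bsub>E\<^esub> x = x \<otimes>\<^bsub>E\<^esub> y [^]\<^bsub>E\<^esub> ?n"
    using x y by (intro kernel_commute) simp_all
  with E.class_two_pow_commute[OF x y c c_comm[OF y] yx, of ?n]
  have "?c [^]\<^bsub>E\<^esub> ?n \<otimes>\<^bsub>E\<^esub> (x \<otimes>\<^bsub>E\<^esub> y [^]\<^bsub>E\<^esub> ?n) = x \<otimes>\<^bsub>E\<^esub> y [^]\<^bsub>E\<^esub> ?n"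
    by (simp only:)
  then have "?c [^]\<^bsub>E\<^esub> ?n = \<one>\<^bsub>E\<^esub>"
    using E.r_cancel_one'[of "x \<otimes>\<^bsub>E\<^esub> y [^]\<^bsub>E\<^esub> ?n" "?c [^]\<^bsub>E\<^esub> ?n"] x y c by simp
  then have "E.ord ?c dvd ?n" using E.pow_eq_id[OF c] by simp
  then obtain j where j: "j \<le> k" "E.ord ?c = 2 ^ j"
    using divides_primepow_nat[OF two_is_prime_nat] by auto
  have "j \<noteq> k"
  proof
    assume "j = k"
    with j have "E.ord ?c = 2 ^ k" by simp
    from order_n_commutator_homocyclic[OF comm exp _ x y this] no show False by simp
  qed
  with j have "j < k" by simp
  \<comment> \<open>With \<open>n = 2 ^ Suc m\<close>, \<open>n choose 2\<close> is
    \<open>2 ^ m * (n - 1)\<close>, a multiple of the order of \<open>c\<close>.\<close>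
  then obtain m where k: "k = Suc m" "j \<le> m" by (cases k) auto
  have "E.ord ?c dvd 2 ^ m" using k j by (simp add: le_imp_power_dvd)
  moreover have "?n choose 2 = 2 ^ m * (?n - 1)"
    unfolding choose_two k by simp
  ultimately have "?c [^]\<^bsub>E\<^esub> (?n choose 2) = \<one>\<^bsub>E\<^esub>" using E.pow_eq_id[OF c] by simp
  with E.class_two_pow_mult[OF x y c c_comm[OF x] c_comm[OF y] yx, of ?n] x y
  show ?thesis by simp
qed

text \<open>Lifts the hypotheses on the finite group \<open>G\<close> to the extension
  \<open>E\<close>: \<open>A\<close> is the kernel of the projection, and the series
  \<open>Z\<close> is pulled back from \<open>upper_pseries\<close>.\<close>

lemma ext_pow_mult_powerful:
  assumes p: "prime p" "p > 2" and powerful: "powerful_p_group p G"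
    and exp: "\<And>g. g \<in> carrier G \<Longrightarrow> g [^] (p ^ e) = \<one>"
    and x: "x \<in> carrier E" and y: "y \<in> carrier E"
  shows "(x \<otimes>\<^bsub>E\<^esub> y) [^]\<^bsub>E\<^esub> (p ^ e) = x [^]\<^bsub>E\<^esub> (p ^ e) \<otimes>\<^bsub>E\<^esub> y [^]\<^bsub>E\<^esub> (p ^ e)"
proof -
  interpret E: group E by (rule E_group)
  interpret s: group_hom E G snd by (rule snd_hom)
  define A where "A = kernel E G snd"
  have A_iff: "z \<in> A \<longleftrightarrow> z \<in> carrier E \<and> snd z = \<one>" for z by (simp add: A_def kernel_def)
  have G: "finite_p_group p G" and der: "derived G (carrier G) \<subseteq> agemo p G"
    using powerful by (auto simp: powerful_p_group_def)
  obtain r where r: "upper_pseries p G r = carrier G"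
    using upper_pseries_exhausts[OF p(1) G] by blast
  let ?S = "(\<lambda>x. x [^]\<^bsub>E\<^esub> p) ` carrier E"
  have S: "?S \<subseteq> carrier E" by auto
  \<comment> \<open>Every element of \<open>G\<close> has a lift, so \<open>agemo p G\<close> is the
    image of the subgroup generated by the \<open>p\<close>-th powers in \<open>E\<close>.\<close>
  have "snd ` ?S = {g [^] p | g. g \<in> carrier G}"
  proof (intro equalityI subsetI)
    fix g assume "g \<in> {g [^] p | g. g \<in> carrier G}"
    then obtain h where h: "h \<in> carrier G" "g = h [^] p" by blast
    have "(1, h) \<in> carrier E" using h by (simp add: cocycle_ext_simps)
    with s.hom_nat_pow[OF this, of p] h show "g \<in> snd ` ?S" by force
  next
    fix g assume "g \<in> snd ` ?S"
    then obtain z where "z \<in> carrier E" "g = snd (z [^]\<^bsub>E\<^esub> p)" by blast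
    then show "g \<in> {g [^] p | g. g \<in> carrier G}"
      using s.hom_nat_pow[of z p] s.hom_closed[of z] by blast
  qed
  then have agemo: "agemo p G = snd ` generate E ?S"
    unfolding agemo_def by (simp flip: s.generate_img[OF S])
  have gen_mono: "generate E ?S \<subseteq> generate E (?S \<union> A)" by (intro E.mono_generate) auto
  have gen_sub: "subgroup (generate E (?S \<union> A)) E"
    using S by (intro E.generate_is_subgroup) (auto simp: A_iff)
  interpret odd_powerful_central_ext E A p e "\<lambda>j. {z \<in> carrier E. snd z \<in> upper_pseries p G j}" r
  proof (intro odd_powerful_central_ext.intro odd_central_ext.intro E_group
      odd_central_ext_axioms.intro odd_powerful_central_ext_axioms.intro)
    show "subgroup A E" unfolding A_def by (rule s.subgroup_kernel)
    show "a \<otimes>\<^bsub>E\<^esub> g = g \<otimes>\<^bsub>E\<^esub> a" if "a \<in> A" "g \<in> carrier E" for a g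
      using that by (intro kernel_commute) (simp_all add: A_iff)
    show "odd p" using p prime_odd_nat by blast
  next
    fix g x assume g: "g \<in> carrier E" and x: "x \<in> carrier E"
    let ?c = "commutator E g x"
    have c: "?c \<in> carrier E" using g x by simp
    have "snd ?c \<in> derived G (carrier G)"
      unfolding derived_def
      by (rule generate.incl, rule UN_I[OF s.hom_closed[OF g]], rule UN_I[OF s.hom_closed[OF x]])
        (simp add: s.hom_commutator[OF g x], simp add: commutator_def)
    \<comment> \<open>The commutator and \<open>z\<close> have the same image, hence differ by an
      element of \<open>A\<close>; this is powerfulness modulo \<open>A\<close>.\<close>
    then obtain z where z: "z \<in> generate E ?S" "snd ?c = snd z"
      using der agemo by auto
    have z': "z \<in> carrier E" using z(1) E.generate_in_carrier[OF S] by blast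
    have "?c \<otimes>\<^bsub>E\<^esub> inv\<^bsub>E\<^esub> z \<in> A"
      using c z' z(2) by (simp add: A_iff s.hom_closed)
    then have "?c \<otimes>\<^bsub>E\<^esub> inv\<^bsub>E\<^esub> z \<in> generate E (?S \<union> A)" by (intro generate.incl) blast
    moreover have "z \<in> generate E (?S \<union> A)" using z(1) gen_mono by blast
    ultimately have "(?c \<otimes>\<^bsub>E\<^esub> inv\<^bsub>E\<^esub> z) \<otimes>\<^bsub>E\<^esub> z \<in> generate E (?S \<union> A)"
      by (rule subgroup.m_closed[OF gen_sub])
    then show "?c \<in> generate E (?S \<union> A)" using c z' by (simp add: E.m_assoc)
  next
    show "x [^]\<^bsub>E\<^esub> (p ^ e) \<in> A" if "x \<in> carrier E" for x
      using that by (simp add: A_iff s.hom_nat_pow exp s.hom_closed)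
    show "{z \<in> carrier E. snd z \<in> upper_pseries p G 0} \<subseteq> A" by (auto simp: A_iff)
    show "carrier E \<subseteq> {z \<in> carrier E. snd z \<in> upper_pseries p G r}"
      by (auto simp only: r s.hom_closed mem_Collect_eq)
  next
    fix j
    have sub: "subgroup (upper_pseries p G j) G" by (rule normal_imp_subgroup[OF upper_pseries_normal])
    show "subgroup {z \<in> carrier E. snd z \<in> upper_pseries p G j} E"
    proof (rule E.subgroupI)
      have "\<one>\<^bsub>E\<^esub> \<in> {z \<in> carrier E. snd z \<in> upper_pseries p G j}"
        using subgroup.one_closed[OF sub] by simp
      then show "{z \<in> carrier E. snd z \<in> upper_pseries p G j} \<noteq> {}" by blast
    qed (use subgroup.m_closed[OF sub] subgroup.m_inv_closed[OF sub] in auto)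
    show "A \<subseteq> {z \<in> carrier E. snd z \<in> upper_pseries p G j}"
      using subgroup.one_closed[OF sub] by (auto simp: A_iff)
    show "x [^]\<^bsub>E\<^esub> p \<in> {z \<in> carrier E. snd z \<in> upper_pseries p G j}"
      if "x \<in> {z \<in> carrier E. snd z \<in> upper_pseries p G (Suc j)}" for x
      using that upper_pseries_pow by (simp add: s.hom_nat_pow)
    show "commutator E g x \<in> {z \<in> carrier E. snd z \<in> upper_pseries p G j}"
      if "g \<in> carrier E" "x \<in> {z \<in> carrier E. snd z \<in> upper_pseries p G (Suc j)}" for g x
      using that upper_pseries_commutator by (simp add: s.hom_commutator s.hom_closed)
  qed
  show ?thesis by (rule pow_mult_distrib_of_powerful[OF x y])
qed

section \<open>Descent of cocycle powers to the quotient and to a complement\<close>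

lemma restrict_subgroup:
  assumes "subgroup K G"
  shows "unit_cocycle (G\<lparr>carrier := K\<rparr>) f"
  unfolding unit_cocycle_def unit_cocycle_axioms_def
  using subgroup_imp_group[OF assms] subgroup.mem_carrier[OF assms] nonzero cocycle by simp

text \<open>On \<open>M\<close> the \<open>n\<close>-th power is a conjugation-invariant
  homomorphism to the scalars; applied to the multiplication rule of lifts it produces
  \<open>u\<close> and \<open>C\<close>. As \<open>C\<close> sees only representatives, the last
  factor is inflated from the quotient when \<open>r\<close> is constant on cosets. The third
  property evaluates it when \<open>r\<close> is multiplicative.\<close>

lemma pow_cohomologous_inflation:
  fixes n :: nat and r :: "'a \<Rightarrow> 'a"
  assumes N: "N \<lhd> G" and exp: "\<And>g. g \<in> N \<Longrightarrow> g [^] n = \<one>"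
    and pow_mult: "\<And>x y. x \<in> (- {0}) \<times> N \<Longrightarrow> y \<in> (- {0}) \<times> N \<Longrightarrow>
      (x \<otimes>\<^bsub>E\<^esub> y) [^]\<^bsub>E\<^esub> n = x [^]\<^bsub>E\<^esub> n \<otimes>\<^bsub>E\<^esub> y [^]\<^bsub>E\<^esub> n"
    and r: "\<And>g. g \<in> carrier G \<Longrightarrow> r g \<in> carrier G" "\<And>g. g \<in> carrier G \<Longrightarrow> N #> r g = N #> g"
  obtains u C where "\<And>g. g \<in> carrier G \<Longrightarrow> u g \<noteq> 0"
    "\<And>g h. g \<in> carrier G \<Longrightarrow> h \<in> carrier G \<Longrightarrow>
      f g h ^ n * u (g \<otimes> h) = u g * u h * C (r g) (r h) (r (g \<otimes> h))"
    "\<And>a b. a \<in> carrier G \<Longrightarrow> b \<in> carrier G \<Longrightarrow> C a b (a \<otimes> b) = f a b ^ n"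
proof -
  interpret E: group E by (rule E_group)
  interpret s: group_hom E G snd by (rule snd_hom)
  interpret N: normal N G by (rule N)
  interpret q: group_hom G "G Mod N" "\<lambda>g. N #> g" by (rule N.group_hom_rcos)
  let ?EN = "(- {0}) \<times> N"
  have EN_iff: "x \<in> ?EN \<longleftrightarrow> x \<in> carrier E \<and> snd x \<in> N" for x
    using N.mem_carrier[of "snd x"] by (cases x) (auto simp: cocycle_ext_simps)
  have EN_carrier: "x \<in> carrier E" if "x \<in> ?EN" for x using that EN_iff by blast
  have EN_mult: "x \<otimes>\<^bsub>E\<^esub> y \<in> ?EN" if "x \<in> ?EN" "y \<in> ?EN" for x y
    using that by (simp only: EN_iff E.m_closed s.hom_mult N.m_closed)
  \<comment> \<open>The scalar exists on \<open>M\<close> because \<open>N\<close> has exponent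
    dividing \<open>n\<close>; by \<open>scalar_inj\<close> the choice is unique.\<close>
  define \<phi> where "\<phi> = (\<lambda>x. SOME z. z \<noteq> 0 \<and> x [^]\<^bsub>E\<^esub> n = scalar z)"
  have \<phi>: "\<phi> x \<noteq> 0 \<and> x [^]\<^bsub>E\<^esub> n = scalar (\<phi> x)" if x: "x \<in> ?EN" for x
  proof -
    have "snd (x [^]\<^bsub>E\<^esub> n) = \<one>" using x exp by (simp only: EN_iff s.hom_nat_pow)
    then obtain z where "z \<noteq> 0" "x [^]\<^bsub>E\<^esub> n = scalar z"
      using scalarE[of "x [^]\<^bsub>E\<^esub> n"] EN_carrier[OF x] by auto
    then have "\<exists>z. z \<noteq> 0 \<and> x [^]\<^bsub>E\<^esub> n = scalar z" by blast
    then show ?thesis unfolding \<phi>_def by (rule someI_ex)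
  qed
  have \<phi>_eqI: "\<phi> x = z" if "x \<in> ?EN" "x [^]\<^bsub>E\<^esub> n = scalar z" for x z
    using \<phi>[OF that(1)] that(2) by (intro scalar_inj) simp
  have \<phi>_mult: "\<phi> (x \<otimes>\<^bsub>E\<^esub> y) = \<phi> x * \<phi> y" if "x \<in> ?EN" "y \<in> ?EN" for x y
    using \<phi>[OF that(1)] \<phi>[OF that(2)] pow_mult[OF that]
    by (intro \<phi>_eqI EN_mult that) (simp add: scalar_mult_scalar)
  have scalar_EN: "scalar z \<in> ?EN" if "z \<noteq> 0" for z
    using scalar_closed[OF that] by (simp only: EN_iff) (simp add: scalar_def)
  have \<phi>_scalar: "\<phi> (scalar z) = z ^ n" if "z \<noteq> 0" for z
    by (intro \<phi>_eqI scalar_EN that scalar_pow)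
  have conj_EN: "y \<otimes>\<^bsub>E\<^esub> x \<otimes>\<^bsub>E\<^esub> inv\<^bsub>E\<^esub> y \<in> ?EN" if "x \<in> ?EN" "y \<in> carrier E" for x y
    using that N.inv_op_closed2[of "snd y" "snd x"]
    by (simp only: EN_iff E.m_closed E.inv_closed s.hom_mult s.hom_inv s.hom_closed)
  have \<phi>_conj: "\<phi> (y \<otimes>\<^bsub>E\<^esub> x \<otimes>\<^bsub>E\<^esub> inv\<^bsub>E\<^esub> y) = \<phi> x" if x: "x \<in> ?EN" and y: "y \<in> carrier E" for x y
  proof (rule \<phi>_eqI[OF conj_EN[OF x y]])
    have "(y \<otimes>\<^bsub>E\<^esub> x \<otimes>\<^bsub>E\<^esub> inv\<^bsub>E\<^esub> y) [^]\<^bsub>E\<^esub> n = y \<otimes>\<^bsub>E\<^esub> scalar (\<phi> x) \<otimes>\<^bsub>E\<^esub> inv\<^bsub>E\<^esub> y"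
      using E.conj_pow[OF y EN_carrier[OF x]] \<phi>[OF x] by simp
    also have "y \<otimes>\<^bsub>E\<^esub> scalar (\<phi> x) = scalar (\<phi> x) \<otimes>\<^bsub>E\<^esub> y" by (rule scalar_commute[OF y, symmetric])
    also have "scalar (\<phi> x) \<otimes>\<^bsub>E\<^esub> y \<otimes>\<^bsub>E\<^esub> inv\<^bsub>E\<^esub> y = scalar (\<phi> x)"
      using y scalar_closed \<phi>[OF x] by (simp add: E.m_assoc)
    finally show "(y \<otimes>\<^bsub>E\<^esub> x \<otimes>\<^bsub>E\<^esub> inv\<^bsub>E\<^esub> y) [^]\<^bsub>E\<^esub> n = scalar (\<phi> x)" .
  qed
  define X :: "'a \<Rightarrow> complex \<times> 'a" where "X g = (1, g)" for g
  have X: "X g \<in> carrier E" if "g \<in> carrier G" for g using that by (simp add: X_def cocycle_ext_simps)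
  have snd_X: "snd (X g) = g" for g by (simp add: X_def)
  have X_mult: "X g \<otimes>\<^bsub>E\<^esub> X h = scalar (f g h) \<otimes>\<^bsub>E\<^esub> X (g \<otimes> h)" if "g \<in> carrier G" "h \<in> carrier G" for g h
    using scalar_mult[OF X[of "g \<otimes> h"]] that by (simp add: X_def cocycle_ext_simps)
  \<comment> \<open>\<open>S g\<close> compares the lift of \<open>g\<close> with that of its
    representative; \<open>c\<close> measures how far the lifts of representatives are from being
    multiplicative.\<close>
  define S where "S g = X g \<otimes>\<^bsub>E\<^esub> inv\<^bsub>E\<^esub> X (r g)" for g
  define c where "c a b d = X a \<otimes>\<^bsub>E\<^esub> X b \<otimes>\<^bsub>E\<^esub> inv\<^bsub>E\<^esub> X d" for a b d
  have in_N: "g \<in> N" if "g \<in> carrier G" "N #> g = N" for g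
    using that N.rcos_eq_one_iff by blast
  have S_EN: "S g \<in> ?EN" if g: "g \<in> carrier G" for g
  proof -
    have "N #> (g \<otimes> inv (r g)) = (N #> g) \<otimes>\<^bsub>G Mod N\<^esub> inv\<^bsub>G Mod N\<^esub> (N #> g)"
      using g r by (simp only: q.hom_mult q.hom_inv inv_closed)
    also have "\<dots> = N" using q.H.r_inv[OF q.hom_closed[OF g]] by simp
    finally have "g \<otimes> inv (r g) \<in> N" using g r by (intro in_N) auto
    then show ?thesis using g r X
      by (simp only: EN_iff S_def E.m_closed E.inv_closed s.hom_mult s.hom_inv snd_X)
  qed
  have c_EN: "c (r g) (r h) (r (g \<otimes> h)) \<in> ?EN" if g: "g \<in> carrier G" and h: "h \<in> carrier G" for g h
  proof -
    have gh: "g \<otimes> h \<in> carrier G" using g h by simp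
    have "N #> (r g \<otimes> r h \<otimes> inv (r (g \<otimes> h))) = (N #> (g \<otimes> h)) \<otimes>\<^bsub>G Mod N\<^esub> inv\<^bsub>G Mod N\<^esub> (N #> (g \<otimes> h))"
      using g h gh r by (simp only: q.hom_mult q.hom_inv inv_closed m_closed)
    also have "\<dots> = N" using q.H.r_inv[OF q.hom_closed[OF gh]] by simp
    finally have "r g \<otimes> r h \<otimes> inv (r (g \<otimes> h)) \<in> N" using g h gh r by (intro in_N) auto
    then show ?thesis using g h gh r X
      by (simp only: EN_iff c_def E.m_closed E.inv_closed s.hom_mult s.hom_inv snd_X)
  qed
  have S_mult: "X g = S g \<otimes>\<^bsub>E\<^esub> X (r g)" if g: "g \<in> carrier G" for g
    using X[OF g] X[OF r(1)[OF g]] by (simp add: S_def E.m_assoc)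
  \<comment> \<open>This is \<open>X g X h = f g h X (g h)\<close> after substituting
    \<open>X g = S g X (r g)\<close>. The conjugation moves \<open>S h\<close> past
    \<open>X (r g)\<close>, and \<open>\<phi>\<close> does not notice it.\<close>
  have main: "S g \<otimes>\<^bsub>E\<^esub> (X (r g) \<otimes>\<^bsub>E\<^esub> S h \<otimes>\<^bsub>E\<^esub> inv\<^bsub>E\<^esub> X (r g)) \<otimes>\<^bsub>E\<^esub> c (r g) (r h) (r (g \<otimes> h)) =
      scalar (f g h) \<otimes>\<^bsub>E\<^esub> S (g \<otimes> h)" if g: "g \<in> carrier G" and h: "h \<in> carrier G" for g h
  proof -
    have gh: "g \<otimes> h \<in> carrier G" using g h by simp
    note cl = X[OF g] X[OF h] X[OF gh] X[OF r(1)[OF g]] X[OF r(1)[OF h]] X[OF r(1)[OF gh]]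
      EN_carrier[OF S_EN[OF g]] EN_carrier[OF S_EN[OF h]] EN_carrier[OF S_EN[OF gh]]
      scalar_closed[OF nonzero[OF g h]]
    have "S g \<otimes>\<^bsub>E\<^esub> (X (r g) \<otimes>\<^bsub>E\<^esub> S h \<otimes>\<^bsub>E\<^esub> inv\<^bsub>E\<^esub> X (r g)) \<otimes>\<^bsub>E\<^esub> c (r g) (r h) (r (g \<otimes> h)) =
        S g \<otimes>\<^bsub>E\<^esub> X (r g) \<otimes>\<^bsub>E\<^esub> S h \<otimes>\<^bsub>E\<^esub> (inv\<^bsub>E\<^esub> X (r g) \<otimes>\<^bsub>E\<^esub> X (r g)) \<otimes>\<^bsub>E\<^esub> X (r h) \<otimes>\<^bsub>E\<^esub> inv\<^bsub>E\<^esub> X (r (g \<otimes> h))"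
      using cl by (simp only: c_def E.m_assoc E.m_closed E.inv_closed)
    also have "\<dots> = (S g \<otimes>\<^bsub>E\<^esub> X (r g)) \<otimes>\<^bsub>E\<^esub> (S h \<otimes>\<^bsub>E\<^esub> X (r h)) \<otimes>\<^bsub>E\<^esub> inv\<^bsub>E\<^esub> X (r (g \<otimes> h))"
      using cl by (simp add: E.m_assoc)
    also have "\<dots> = scalar (f g h) \<otimes>\<^bsub>E\<^esub> X (g \<otimes> h) \<otimes>\<^bsub>E\<^esub> inv\<^bsub>E\<^esub> X (r (g \<otimes> h))"
      by (simp only: X_mult[OF g h] flip: S_mult[OF g] S_mult[OF h])
    also have "\<dots> = scalar (f g h) \<otimes>\<^bsub>E\<^esub> S (g \<otimes> h)"
      using cl by (simp add: S_def[of "g \<otimes> h"] E.m_assoc)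
    finally show ?thesis .
  qed
  show thesis
  proof (rule that[of "\<lambda>g. \<phi> (S g)" "\<lambda>a b d. \<phi> (c a b d)"])
    show "\<phi> (S g) \<noteq> 0" if "g \<in> carrier G" for g using \<phi> S_EN that by blast
  next
    fix g h assume g: "g \<in> carrier G" and h: "h \<in> carrier G"
    then have gh: "g \<otimes> h \<in> carrier G" by simp
    let ?S' = "X (r g) \<otimes>\<^bsub>E\<^esub> S h \<otimes>\<^bsub>E\<^esub> inv\<^bsub>E\<^esub> X (r g)"
    note Sh' = conj_EN[OF S_EN[OF h] X[OF r(1)[OF g]]]
    have "\<phi> (S g \<otimes>\<^bsub>E\<^esub> ?S' \<otimes>\<^bsub>E\<^esub> c (r g) (r h) (r (g \<otimes> h))) = \<phi> (S g) * \<phi> (S h) * \<phi> (c (r g) (r h) (r (g \<otimes> h)))"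
      by (simp only: \<phi>_mult EN_mult S_EN[OF g] Sh' c_EN[OF g h] \<phi>_conj[OF S_EN[OF h] X[OF r(1)[OF g]]])
    moreover have "\<phi> (scalar (f g h) \<otimes>\<^bsub>E\<^esub> S (g \<otimes> h)) = f g h ^ n * \<phi> (S (g \<otimes> h))"
      by (simp only: \<phi>_mult[OF scalar_EN[OF nonzero[OF g h]] S_EN[OF gh]] \<phi>_scalar[OF nonzero[OF g h]])
    ultimately show "f g h ^ n * \<phi> (S (g \<otimes> h)) = \<phi> (S g) * \<phi> (S h) * \<phi> (c (r g) (r h) (r (g \<otimes> h)))"
      unfolding main[OF g h] by simp
  next
    fix a b assume a: "a \<in> carrier G" and b: "b \<in> carrier G"
    have "c a b (a \<otimes> b) = scalar (f a b)"
      using X[of "a \<otimes> b"] a b scalar_closed[OF nonzero[OF a b]]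
      by (simp add: c_def X_mult E.m_assoc)
    then show "\<phi> (c a b (a \<otimes> b)) = f a b ^ n" using nonzero[OF a b] by (simp add: \<phi>_scalar)
  qed
qed

text \<open>The inflated factor is a cocycle \<open>\<beta>\<close> of \<open>G / N\<close>.
  Triviality of the multiplier makes it the coboundary of some \<open>v\<close>, and
  \<open>u\<close> times the inflation of \<open>v\<close> works for \<open>f ^ n\<close>.\<close>

lemma pow_coboundary_of_trivial_quotient:
  fixes n :: nat
  assumes N: "N \<lhd> G" and exp: "\<And>g. g \<in> N \<Longrightarrow> g [^] n = \<one>"
    and pow_mult: "\<And>x y. x \<in> (- {0}) \<times> N \<Longrightarrow> y \<in> (- {0}) \<times> N \<Longrightarrow>
      (x \<otimes>\<^bsub>E\<^esub> y) [^]\<^bsub>E\<^esub> n = x [^]\<^bsub>E\<^esub> n \<otimes>\<^bsub>E\<^esub> y [^]\<^bsub>E\<^esub> n"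
    and trivial: "trivial_group (schur_multiplier (G Mod N))"
  shows "unit_coboundary G (\<lambda>g h. f g h ^ n)"
proof -
  interpret N: normal N G by (rule N)
  interpret q: group_hom G "G Mod N" "\<lambda>g. N #> g" by (rule N.group_hom_rcos)
  \<comment> \<open>Choosing from the coset itself makes the representative depend only on the
    coset.\<close>
  define t where "t P = (SOME g. g \<in> P)" for P :: "'a set"
  have t: "t (N #> g) \<in> N #> g" if "g \<in> carrier G" for g
    unfolding t_def using rcos_self[OF that N.is_subgroup] by (rule someI)
  have r1: "t (N #> g) \<in> carrier G" if "g \<in> carrier G" for g
    using t[OF that] r_coset_subset_G[OF N.subset that] by blast
  have r2: "N #> t (N #> g) = N #> g" if "g \<in> carrier G" for g
    using repr_independence[OF t[OF that] that N.is_subgroup] by simp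
  obtain u C where u: "\<And>g. g \<in> carrier G \<Longrightarrow> u g \<noteq> 0"
    and eq: "\<And>g h. g \<in> carrier G \<Longrightarrow> h \<in> carrier G \<Longrightarrow>
      f g h ^ n * u (g \<otimes> h) = u g * u h * C (t (N #> g)) (t (N #> h)) (t (N #> (g \<otimes> h)))"
  proof (rule pow_cohomologous_inflation[OF N, of n "\<lambda>g. t (N #> g)"])
    fix u C
    assume "\<And>g. g \<in> carrier G \<Longrightarrow> u g \<noteq> 0"
      "\<And>g h. g \<in> carrier G \<Longrightarrow> h \<in> carrier G \<Longrightarrow>
        f g h ^ n * u (g \<otimes> h) = u g * u h * C (t (N #> g)) (t (N #> h)) (t (N #> (g \<otimes> h)))"
    then show thesis by (rule that)
  qed (assumption | rule exp pow_mult r1 r2)+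
  define \<beta> where "\<beta> P Q = C (t P) (t Q) (t (P \<otimes>\<^bsub>G Mod N\<^esub> Q))" for P Q
  \<comment> \<open>This expresses \<open>\<beta>\<close> through \<open>f ^ n\<close> and
    \<open>u\<close>, so its cocycle identity follows from that of \<open>f\<close> without looking
    into \<open>C\<close>.\<close>
  have \<beta>: "\<beta> (N #> g) (N #> h) = f g h ^ n * u (g \<otimes> h) / (u g * u h)"
    if "g \<in> carrier G" "h \<in> carrier G" for g h
    unfolding \<beta>_def q.hom_mult[OF that, symmetric] using eq[OF that] u that by (simp add: divide_simps)
  have "unit_cocycle (G Mod N) \<beta>"
    unfolding unit_cocycle_def unit_cocycle_axioms_def
  proof (intro conjI allI impI)
    show "group (G Mod N)" by (rule N.factorgroup_is_group)
    fix P Q assume "P \<in> carrier (G Mod N)" "Q \<in> carrier (G Mod N)"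
    then obtain g h where "g \<in> carrier G" "P = N #> g" "h \<in> carrier G" "Q = N #> h"
      by (auto simp: carrier_FactGroup)
    then show "\<beta> P Q \<noteq> 0" using \<beta>[of g h] u nonzero by simp
  next
    fix P Q R assume "P \<in> carrier (G Mod N)" "Q \<in> carrier (G Mod N)" "R \<in> carrier (G Mod N)"
    then obtain g h k where g: "g \<in> carrier G" "P = N #> g" and h: "h \<in> carrier G" "Q = N #> h"
      and k: "k \<in> carrier G" "R = N #> k"
      by (auto simp: carrier_FactGroup)
    have gh: "g \<otimes> h \<in> carrier G" and hk: "h \<otimes> k \<in> carrier G" using g h k by auto
    have "\<beta> (N #> g) (N #> h) * \<beta> (N #> (g \<otimes> h)) (N #> k) =
        (f g h * f (g \<otimes> h) k) ^ n * u (g \<otimes> h \<otimes> k) / (u g * u h * u k)"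
      using u[OF gh] by (simp add: \<beta>[OF g(1) h(1)] \<beta>[OF gh k(1)] power_mult_distrib mult.assoc)
    also have "\<dots> = (f h k * f g (h \<otimes> k)) ^ n * u (g \<otimes> (h \<otimes> k)) / (u g * u h * u k)"
      using cocycle[OF g(1) h(1) k(1)] g h k by (simp add: m_assoc)
    also have "\<dots> = \<beta> (N #> h) (N #> k) * \<beta> (N #> g) (N #> (h \<otimes> k))"
      using u[OF hk] by (simp add: \<beta>[OF h(1) k(1)] \<beta>[OF g(1) hk] power_mult_distrib ac_simps)
    finally show "\<beta> P Q * \<beta> (P \<otimes>\<^bsub>G Mod N\<^esub> Q) R = \<beta> Q R * \<beta> P (Q \<otimes>\<^bsub>G Mod N\<^esub> R)"
      unfolding g(2) h(2) k(2) q.hom_mult[OF g(1) h(1), symmetric] q.hom_mult[OF h(1) k(1), symmetric] .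
  qed
  from q.H.unit_coboundary_of_trivial[OF this trivial]
  obtain v where v: "\<And>P. P \<in> carrier (G Mod N) \<Longrightarrow> v P \<noteq> 0"
    and veq: "\<And>P Q. P \<in> carrier (G Mod N) \<Longrightarrow> Q \<in> carrier (G Mod N) \<Longrightarrow>
      \<beta> P Q * v (P \<otimes>\<^bsub>G Mod N\<^esub> Q) = v P * v Q"
    unfolding unit_coboundary_def by blast
  show ?thesis
    unfolding unit_coboundary_def
  proof (intro exI[of _ "\<lambda>g. u g * v (N #> g)"] conjI ballI)
    show "u g * v (N #> g) \<noteq> 0" if "g \<in> carrier G" for g
      using u[OF that] v[OF q.hom_closed[OF that]] by simp
    fix g h assume g: "g \<in> carrier G" and h: "h \<in> carrier G"
    have "\<beta> (N #> g) (N #> h) * v (N #> (g \<otimes> h)) = v (N #> g) * v (N #> h)"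
      unfolding q.hom_mult[OF g h] by (rule veq[OF q.hom_closed[OF g] q.hom_closed[OF h]])
    then show "f g h ^ n * (u (g \<otimes> h) * v (N #> (g \<otimes> h))) = u g * v (N #> g) * (u h * v (N #> h))"
      using u[OF g] u[OF h] by (simp add: \<beta>[OF g h] divide_simps ac_simps)
  qed
qed

text \<open>With representatives in \<open>H\<close>, \<open>r\<close> is the projection
  homomorphism onto \<open>H\<close>, and the inflated factor is \<open>f (r g) (r h) ^ n\<close>, a
  coboundary on \<open>H\<close> by the bound on the exponent of its multiplier.\<close>

lemma pow_coboundary_of_complement:
  fixes n :: nat
  assumes N: "N \<lhd> G" and exp: "\<And>g. g \<in> N \<Longrightarrow> g [^] n = \<one>"
    and pow_mult: "\<And>x y. x \<in> (- {0}) \<times> N \<Longrightarrow> y \<in> (- {0}) \<times> N \<Longrightarrow>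
      (x \<otimes>\<^bsub>E\<^esub> y) [^]\<^bsub>E\<^esub> n = x [^]\<^bsub>E\<^esub> n \<otimes>\<^bsub>E\<^esub> y [^]\<^bsub>E\<^esub> n"
    and H: "is_complement G N H"
    and dvd: "group_exponent (schur_multiplier (G\<lparr>carrier := H\<rparr>)) dvd n"
  shows "unit_coboundary G (\<lambda>g h. f g h ^ n)"
proof -
  interpret N: normal N G by (rule N)
  interpret q: group_hom G "G Mod N" "\<lambda>g. N #> g" by (rule N.group_hom_rcos)
  from H have sub: "subgroup H G" and inter: "N \<inter> H = {\<one>}" and prod: "N <#> H = carrier G"
    by (auto simp: is_complement_def)
  have HG: "h \<in> carrier G" if "h \<in> H" for h using subgroup.mem_carrier[OF sub that] .
  define r where "r g = (SOME h. h \<in> H \<and> N #> h = N #> g)" for g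
  have r: "r g \<in> H \<and> N #> r g = N #> g" if g: "g \<in> carrier G" for g
  proof -
    from g have "g \<in> N <#> H" by (simp add: prod)
    then obtain m h where mh: "m \<in> N" "h \<in> H" "g = m \<otimes> h" by (auto simp: set_mult_def)
    then have "N #> h = N #> g" using N.rcos_mult_left HG by simp
    with mh have "\<exists>h. h \<in> H \<and> N #> h = N #> g" by blast
    then show ?thesis unfolding r_def by (rule someI_ex)
  qed
  \<comment> \<open>Two elements of \<open>H\<close> in one coset differ by an element of both
    \<open>N\<close> and \<open>H\<close>; this uniqueness makes \<open>r\<close>
    multiplicative.\<close>
  have uniq: "h = k" if h: "h \<in> H" and k: "k \<in> H" and eq: "N #> h = N #> k" for h k
  proof -
    obtain m where m: "m \<in> N" "h = m \<otimes> k" using N.rcos_eqD[OF HG[OF h] HG[OF k] eq] by blast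
    then have "m = h \<otimes> inv k" using HG[OF k] by (simp add: m_assoc)
    then have "m \<in> H" using h k sub by (simp add: subgroup.m_closed subgroup.m_inv_closed)
    with m inter have "m = \<one>" by blast
    with m HG[OF k] show ?thesis by simp
  qed
  have r_mult: "r (g \<otimes> h) = r g \<otimes> r h" if g: "g \<in> carrier G" and h: "h \<in> carrier G" for g h
  proof (rule uniq)
    have rg: "r g \<in> carrier G" and rh: "r h \<in> carrier G" using r g h HG by auto
    show "N #> r (g \<otimes> h) = N #> (r g \<otimes> r h)"
      unfolding q.hom_mult[OF rg rh] using r g h by (simp only: q.hom_mult m_closed)
  qed (use r g h sub in \<open>auto intro: subgroup.m_closed\<close>)
  obtain u C where u: "\<And>g. g \<in> carrier G \<Longrightarrow> u g \<noteq> 0"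
    and eq: "\<And>g h. g \<in> carrier G \<Longrightarrow> h \<in> carrier G \<Longrightarrow>
      f g h ^ n * u (g \<otimes> h) = u g * u h * C (r g) (r h) (r (g \<otimes> h))"
    and C: "\<And>a b. a \<in> carrier G \<Longrightarrow> b \<in> carrier G \<Longrightarrow> C a b (a \<otimes> b) = f a b ^ n"
  proof (rule pow_cohomologous_inflation[OF N, of n r])
    fix u C
    assume "\<And>g. g \<in> carrier G \<Longrightarrow> u g \<noteq> 0"
      "\<And>g h. g \<in> carrier G \<Longrightarrow> h \<in> carrier G \<Longrightarrow>
        f g h ^ n * u (g \<otimes> h) = u g * u h * C (r g) (r h) (r (g \<otimes> h))"
      "\<And>a b. a \<in> carrier G \<Longrightarrow> b \<in> carrier G \<Longrightarrow> C a b (a \<otimes> b) = f a b ^ n"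
    then show thesis by (rule that)
  qed (assumption | rule exp pow_mult r[THEN conjunct1, THEN HG] r[THEN conjunct2])+
  from group.unit_coboundary_pow[OF subgroup_imp_group[OF sub] restrict_subgroup[OF sub] dvd]
  obtain v where v: "\<And>a. a \<in> H \<Longrightarrow> v a \<noteq> 0"
    and veq: "\<And>a b. a \<in> H \<Longrightarrow> b \<in> H \<Longrightarrow> f a b ^ n * v (a \<otimes> b) = v a * v b"
    unfolding unit_coboundary_def by auto
  show ?thesis
    unfolding unit_coboundary_def
  proof (intro exI[of _ "\<lambda>g. u g * v (r g)"] conjI ballI)
    show "u g * v (r g) \<noteq> 0" if "g \<in> carrier G" for g using u v r that by simp
    fix g h assume g: "g \<in> carrier G" and h: "h \<in> carrier G"
    have "f g h ^ n * u (g \<otimes> h) * v (r (g \<otimes> h)) = u g * u h * (f (r g) (r h) ^ n * v (r g \<otimes> r h))"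
      using eq[OF g h] C[of "r g" "r h"] r HG g h by (simp add: r_mult)
    also have "f (r g) (r h) ^ n * v (r g \<otimes> r h) = v (r g) * v (r h)"
      using veq r g h by simp
    finally show "f g h ^ n * (u (g \<otimes> h) * v (r (g \<otimes> h))) = u g * v (r g) * (u h * v (r h))"
      by (simp add: ac_simps)
  qed
qed

end

section \<open>Combination of the cases\<close>

theorem corollary4:
  fixes p :: nat and G :: "('a, 'b) monoid_scheme" and N :: "'a set"
  assumes "prime p"
    and "finite_p_group p G"
    and "N \<lhd> G"
    and "(p = 2 \<and> comm_group (G\<lparr>carrier := N\<rparr>) \<and>
           (\<exists>k. 2 ^ k = group_exponent G \<and>
              \<not> (\<exists>A. subgroup A (G\<lparr>carrier := N\<rparr>) \<and>
                   G\<lparr>carrier := A\<rparr> \<cong> integer_mod_group (2 ^ k) \<times>\<times> integer_mod_group (2 ^ k)))) \<or>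
         (p > 2 \<and> powerful_p_group p (G\<lparr>carrier := N\<rparr>))"
    and "trivial_group (schur_multiplier (G Mod N)) \<or>
         (\<exists>H. is_complement G N H \<and>
            group_exponent (schur_multiplier (G\<lparr>carrier := H\<rparr>))
              dvd group_exponent (G\<lparr>carrier := H\<rparr>))"
  shows "group_exponent (schur_multiplier G) dvd group_exponent G"
proof -
  from assms(2) obtain m where "group G" and fin: "finite (carrier G)" and ord: "order G = p ^ m"
    by (auto simp: finite_p_group_def)
  interpret group G by fact
  have sub: "subgroup N G" using assms(3) by (rule normal_imp_subgroup)
  let ?n = "group_exponent G" and ?GN = "G\<lparr>carrier := N\<rparr>"
  \<comment> \<open>This makes the exponent positive and, for odd \<open>p\<close>, a power of
    \<open>p\<close>.\<close>
  have n_dvd: "?n dvd p ^ m"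
    unfolding ord[symmetric]
    by (rule group_exponent_dvd) (use fin order_gt_0_iff_finite pow_order_eq_1 in auto)
  then have n_pos: "?n > 0" using assms(1) by (auto intro: gr0I simp: prime_gt_0_nat)
  have exp: "g [^]\<^bsub>G\<^esub> ?n = \<one>\<^bsub>G\<^esub>" if "g \<in> carrier G" for g using pow_group_exponent[OF that] .
  have exp_N: "g [^]\<^bsub>?GN\<^esub> ?n = \<one>\<^bsub>?GN\<^esub>" if "g \<in> carrier ?GN" for g
    using exp[of g] subgroup.mem_carrier[OF sub] that by (simp flip: nat_pow_consistent)
  show ?thesis
  proof (rule group_exponent_schur_multiplier_dvd[OF n_pos])
    fix f assume "unit_cocycle G f"
    then interpret f: unit_cocycle G f .
    interpret fN: unit_cocycle ?GN f by (rule f.restrict_subgroup[OF sub])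
    have pow_N: "(x \<otimes>\<^bsub>fN.E\<^esub> y) [^]\<^bsub>fN.E\<^esub> ?n = x [^]\<^bsub>fN.E\<^esub> ?n \<otimes>\<^bsub>fN.E\<^esub> y [^]\<^bsub>fN.E\<^esub> ?n"
      if x: "x \<in> carrier fN.E" and y: "y \<in> carrier fN.E" for x y
      using assms(4)
    proof (elim disjE conjE exE)
      fix k assume comm: "comm_group ?GN" and k: "2 ^ k = ?n"
        and no: "\<not> (\<exists>A. subgroup A ?GN \<and>
          G\<lparr>carrier := A\<rparr> \<cong> integer_mod_group (2 ^ k) \<times>\<times> integer_mod_group (2 ^ k))"
      interpret c: comm_group ?GN by (rule comm)
      show ?thesis
        unfolding k[symmetric]
      proof (rule fN.ext_pow_mult_abelian_two_group[OF c.m_comm _ _ x y])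
        show "\<nexists>A. subgroup A ?GN \<and>
            ?GN\<lparr>carrier := A\<rparr> \<cong> integer_mod_group (2 ^ k) \<times>\<times> integer_mod_group (2 ^ k)"
          using no by simp
      qed (use exp_N k in simp_all)
    next
      assume p: "2 < p" and powerful: "powerful_p_group p ?GN"
      obtain e where e: "?n = p ^ e" using n_dvd divides_primepow_nat[OF assms(1)] by auto
      show ?thesis
        unfolding e
        by (rule fN.ext_pow_mult_powerful[OF assms(1) p powerful _ x y]) (use exp_N e in simp)
    qed
    \<comment> \<open>The power law was obtained in the extension of \<open>N\<close>; here it is
      read inside the extension of \<open>G\<close>.\<close>
    have pow_mult: "(x \<otimes>\<^bsub>f.E\<^esub> y) [^]\<^bsub>f.E\<^esub> ?n = x [^]\<^bsub>f.E\<^esub> ?n \<otimes>\<^bsub>f.E\<^esub> y [^]\<^bsub>f.E\<^esub> ?n"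
      if "x \<in> (- {0}) \<times> N" "y \<in> (- {0}) \<times> N" for x y
    proof -
      interpret E: group f.E by (rule f.E_group)
      show ?thesis
        using pow_N[of x y] that
        by (simp add: cocycle_ext_restrict flip: E.nat_pow_consistent)
    qed
    have exp': "g [^]\<^bsub>G\<^esub> ?n = \<one>\<^bsub>G\<^esub>" if "g \<in> N" for g
      using exp subgroup.mem_carrier[OF sub that] by blast
    from assms(5) show "unit_coboundary G (\<lambda>g h. f g h ^ ?n)"
    proof (elim disjE exE conjE)
      assume "trivial_group (schur_multiplier (G Mod N))"
      with exp' pow_mult show ?thesis by (rule f.pow_coboundary_of_trivial_quotient[OF assms(3)])
    next
      fix H assume H: "is_complement G N H"
        and dvd: "group_exponent (schur_multiplier (G\<lparr>carrier := H\<rparr>)) dvd group_exponent (G\<lparr>carrier := H\<rparr>)"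
      have sub: "subgroup H G" using H by (simp add: is_complement_def)
      \<comment> \<open>The exponent of a subgroup divides that of \<open>G\<close>, so the bound
        for the multiplier of \<open>H\<close> can be weakened to \<open>n\<close>.\<close>
      have "group_exponent (G\<lparr>carrier := H\<rparr>) dvd ?n"
        using exp subgroup.mem_carrier[OF sub] n_pos
        by (intro group.group_exponent_dvd[OF subgroup_imp_group[OF sub]])
          (simp_all flip: nat_pow_consistent)
      with dvd have "group_exponent (schur_multiplier (G\<lparr>carrier := H\<rparr>)) dvd ?n"
        by (rule dvd_trans)
      with exp' pow_mult H show ?thesis by (rule f.pow_coboundary_of_complement[OF assms(3)])
    qed
  qed
qed

end
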